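(* Let $d\ge 1$, let $\bullet\in\{\mathrm{star},\mathrm{extr},\mathrm{per}\}$, let $k\ge 1$ be an integer, and let $\mathcal{P}_k=\{\boldsymbol{x}_1,\dots,\boldsymbol{x}_k\}\subset[0,1)^d$ be arbitrary. Let $\mathcal{S}_d^{\bullet}=\{\boldsymbol{x}_1,\boldsymbol{x}_2,\dots\}\subset[0,1)^d$ be any sequence starting with $\boldsymbol{x}_1,\dots,\boldsymbol{x}_k$ such that for every $N\ge k$ $$\boldsymbol{x}_{N+1}\in\operatorname*{arg\,min}_{\boldsymbol{y}\in[0,1)^d}L_{2,N+1}^{\bullet}(\{\boldsymbol{x}_1,\dots,\boldsymbol{x}_N,\boldsymbol{y}\}).$$ Then for all $N\ge k$ $$L_{2,N}^{\bullet}(\mathcal{S}_d^{\bullet})^2\le\max\{c_d^{\bullet},L_{2,k}^{\bullet}(\mathcal{P}_k)^2\}\cdot(N-k+1),$$ where $$c_d^{\mathrm{star}}=c_d^{\mathrm{per}}:=\frac1{2^d}-\frac1{3^d}\quad\text{and}\quad c_d^{\mathrm{extr}}:=\frac1{6^d}-\frac1{12^d}.$$ In particular, the sequence $\mathcal{S}_d^{\bullet}$ is uniformly distributed modulo 1.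
   Context: For a (finite with at least $N$ members, or infinite) sequence $\mathcal{S}=\{\boldsymbol{x}_1,\boldsymbol{x}_2,\dots\}$ of points in $[0,1]^d$ (repetitions allowed, counted with multiplicity) and a measurable set $B\subseteq[0,1]^d$ with Lebesgue measure $|B|$, let $\Delta_N(B,\mathcal{S}):=\#\{n\in\{1,\dots,N\}:\boldsymbol{x}_n\in B\}-N|B|$. For $\boldsymbol{t}\in[0,1]^d$ let $[\boldsymbol{0},\boldsymbol{t})=\prod_{i=1}^d[0,t_i)$. For $\boldsymbol{x},\boldsymbol{y}\in[0,1]^d$ write $\boldsymbol{x}\le\boldsymbol{y}$ if $x_i\le y_i$ for all $i$, and then $[\boldsymbol{x},\boldsymbol{y})=\prod_{i=1}^d[x_i,y_i)$. For $x,y\in[0,1]$ let $I(x,y)=[x,y)$ if $x\le y$ and $I(x,y)=[0,y)\cup[x,1)$ if $x>y$; for $\boldsymbol{x},\boldsymbol{y}\in[0,1]^d$ let $B(\boldsymbol{x},\boldsymbol{y})=\prod_{i=1}^dI(x_i,y_i)$. The star, extreme and periodic $L_2$ discrepancies are $$L_{2,N}^{\mathrm{star}}(\mathcal{S}):=\Big(\int_{[0,1]^d}|\Delta_N([\boldsymbol{0},\boldsymbol{t}),\mathcal{S})|^2\,\mathrm{d}\boldsymbol{t}\Big)^{1/2},$$ $$L_{2,N}^{\mathrm{extr}}(\mathcal{S}):=\Big(\int_{[0,1]^d}\int_{[0,1]^d,\,\boldsymbol{x}\le\boldsymbol{y}}|\Delta_N([\boldsymbol{x},\boldsymbol{y}),\mathcal{S})|^2\,\mathrm{d}\boldsymbol{x}\,\mathrm{d}\boldsymbol{y}\Big)^{1/2},$$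 $$L_{2,N}^{\mathrm{per}}(\mathcal{S}):=\Big(\int_{[0,1]^d}\int_{[0,1]^d}|\Delta_N(B(\boldsymbol{x},\boldsymbol{y}),\mathcal{S})|^2\,\mathrm{d}\boldsymbol{x}\,\mathrm{d}\boldsymbol{y}\Big)^{1/2}.$$ $\operatorname*{arg\,min}_{x\in M}f(x)$ denotes the set $\{x\in M: f(x)\le f(y)\text{ for all }y\in M\}$. A sequence $\mathcal{S}=\{\boldsymbol{x}_1,\boldsymbol{x}_2,\dots\}\subset[0,1)^d$ is uniformly distributed modulo 1 if $\lim_{N\to\infty}\frac1N\#\{n\in\{1,\dots,N\}:\boldsymbol{x}_n\in[\boldsymbol{x},\boldsymbol{y})\}=|[\boldsymbol{x},\boldsymbol{y})|$ for all intervals $[\boldsymbol{x},\boldsymbol{y})\subseteq[0,1]^d$. *)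

theory Defs
  imports "HOL-Analysis.Analysis"
begin

definition unit_cube :: "(real ^ 'd) set" where
  "unit_cube = {x. \<forall>i. 0 \<le> x $ i \<and> x $ i \<le> 1}"

definition ho_unit_cube :: "(real ^ 'd) set" where
  "ho_unit_cube = {x. \<forall>i. 0 \<le> x $ i \<and> x $ i < 1}"

definition ho_box :: "real ^ 'd \<Rightarrow> real ^ 'd \<Rightarrow> (real ^ 'd) set" where
  "ho_box x y = {z. \<forall>i. x $ i \<le> z $ i \<and> z $ i < y $ i}"

definition per_interval :: "real \<Rightarrow> real \<Rightarrow> real set" where
  "per_interval x y = (if x \<le> y then {x..<y} else {0..<y} \<union> {x..<1})"

definition per_box :: "real ^ 'd \<Rightarrow> real ^ 'd \<Rightarrow> (real ^ 'd) set" where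
  "per_box x y = {z. \<forall>i. z $ i \<in> per_interval (x $ i) (y $ i)}"

(* Sequences are total functions on nat and the points are X 1, X 2, ...; the value X 0
   is never used. A finite sequence with at least N members is any X agreeing with it
   on {1..N}. *)

definition local_disc :: "nat \<Rightarrow> (real ^ 'd) set \<Rightarrow> (nat \<Rightarrow> real ^ 'd) \<Rightarrow> real" where
  "local_disc N B X = real (card {n \<in> {1..N}. X n \<in> B}) - real N * measure lebesgue B"

(* The integrands below are bounded Borel functions, so integrating against lborel
   gives their integrals with respect to Lebesgue measure. The order on real ^ 'd is
   componentwise. *)

definition L2_star :: "nat \<Rightarrow> (nat \<Rightarrow> real ^ 'd) \<Rightarrow> real" where
  "L2_star N X = sqrt (LINT t:unit_cube|lborel. \<bar>local_disc N (ho_box 0 t) X\<bar>\<^sup>2)"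

definition L2_extr :: "nat \<Rightarrow> (nat \<Rightarrow> real ^ 'd) \<Rightarrow> real" where
  "L2_extr N X =
     sqrt (LINT y:unit_cube|lborel. (LINT x:{x \<in> unit_cube. x \<le> y}|lborel.
       \<bar>local_disc N (ho_box x y) X\<bar>\<^sup>2))"

definition L2_per :: "nat \<Rightarrow> (nat \<Rightarrow> real ^ 'd) \<Rightarrow> real" where
  "L2_per N X =
     sqrt (LINT y:unit_cube|lborel. (LINT x:unit_cube|lborel.
       \<bar>local_disc N (per_box x y) X\<bar>\<^sup>2))"

datatype disc_kind = Star | Extr | Per

fun L2_disc :: "disc_kind \<Rightarrow> nat \<Rightarrow> (nat \<Rightarrow> real ^ 'd) \<Rightarrow> real" where
  "L2_disc Star = L2_star"
| "L2_disc Extr = L2_extr"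
| "L2_disc Per = L2_per"

fun disc_const :: "disc_kind \<Rightarrow> nat \<Rightarrow> real" where
  "disc_const Star d = 1 / 2 ^ d - 1 / 3 ^ d"
| "disc_const Extr d = 1 / 6 ^ d - 1 / 12 ^ d"
| "disc_const Per d = 1 / 2 ^ d - 1 / 3 ^ d"

definition argmin_on :: "'a set \<Rightarrow> ('a \<Rightarrow> real) \<Rightarrow> 'a set" where
  "argmin_on M f = {x \<in> M. \<forall>y \<in> M. f x \<le> f y}"

definition uniformly_distributed_mod1 :: "(nat \<Rightarrow> real ^ 'd) \<Rightarrow> bool" where
  "uniformly_distributed_mod1 X \<longleftrightarrow>
     (\<forall>n\<ge>1. X n \<in> ho_unit_cube) \<and>
     (\<forall>x \<in> unit_cube. \<forall>y \<in> unit_cube. x \<le> y \<longrightarrow>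
       (\<lambda>N. real (card {n \<in> {1..N}. X n \<in> ho_box x y}) / real N)
         \<longlonglongrightarrow> measure lebesgue (ho_box x y))"

end

theory Submission
  imports Defs "HOL-Probability.Probability_Measure"
begin

text \<open>Let \<open>\<Delta>\<^sub>N(w)\<close> be the local discrepancy of the test set \<open>B w\<close>, where \<open>w\<close> ranges over a finite measure
  space \<open>M\<close>. Appending \<open>y\<close> changes \<open>\<Delta>\<^sub>N(w)\<close> by \<open>1 - |B w|\<close> or \<open>- |B w|\<close>, so the average over \<open>y\<close> in the cube of
  the new squared \<open>L\<^sub>2\<close> discrepancy is the old one plus \<open>\<integral> |B w| - |B w|\<^sup>2\<close>; the greedy choice does at least
  as well as the average.

  Linear growth of the squared discrepancy gives \<open>\<integral> G \<Delta>\<^sub>N = O(sqrt N)\<close> for every bounded weight \<open>G\<close>, so the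
  averages of \<open>f z = \<integral> G w * [z \<in> B w]\<close> along the sequence converge to the integral of \<open>f\<close>.
  For each kind of discrepancy such functions \<open>f\<close> can be squeezed between the indicators of a slightly shrunk
  box and of the box itself, which bounds the frequency of the box from below; upper bounds follow because
  the boxes cutting up the cube share the total mass 1.\<close>

subsection \<open>Integrals of products over the coordinates\<close>

text \<open>\<open>lborel\<close> is built from a product measure over \<open>Basis\<close>. This
  lemma and the next one re-index such products by the coordinates of a vector.\<close>

lemma vec_prod_Basis:
  fixes f :: "'d::finite \<Rightarrow> real \<Rightarrow> real" and x :: "real ^ 'd"
  shows "(\<Prod>b\<in>Basis. f (axis_index b) (x \<bullet> b)) = (\<Prod>i\<in>UNIV. f i (x $ i))"
  by (simp add: Basis_vec_def UNION_singleton_eq_range prod.reindex axis_eq_axis inj_on_def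
      cart_eq_inner_axis)

lemma vec_prod_Basis_const:
  fixes f :: "'d::finite \<Rightarrow> real"
  shows "(\<Prod>b\<in>(Basis::(real^'d) set). f (axis_index b)) = (\<Prod>i\<in>UNIV. f i)"
  by (simp add: Basis_vec_def UNION_singleton_eq_range prod.reindex axis_eq_axis inj_on_def)

lemma borel_measurable_vec_nth [measurable]:
  "(\<lambda>x::real^'d. x $ i) \<in> borel_measurable borel"
  by (intro borel_measurable_continuous_onI continuous_intros)

text \<open>Fubini in product form: \<open>lborel\<close> is the image of the product of
  one-dimensional Lebesgue measures over \<open>Basis\<close>, and under such a product the integral
  of a product of functions of single coordinates factors.\<close>

lemma integral_lborel_vec_prod:
  fixes f :: "'d::finite \<Rightarrow> real \<Rightarrow> real"
  assumes f: "\<And>i. integrable lborel (f i)"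
  shows "(\<integral>x. (\<Prod>i\<in>UNIV. f i (x $ i)) \<partial>(lborel :: (real^'d) measure)) = (\<Prod>i\<in>UNIV. \<integral>t. f i t \<partial>lborel)"
proof -
  interpret product_sigma_finite "\<lambda>b::real^'d. lborel :: real measure" ..
  have [measurable]: "\<And>i. f i \<in> borel_measurable borel"
    using f by (auto dest: borel_measurable_integrable)
  have "(\<integral>x. (\<Prod>i\<in>UNIV. f i (x $ i)) \<partial>(lborel :: (real^'d) measure)) =
     (\<integral>x. (\<Prod>b\<in>Basis. f (axis_index b) (x \<bullet> b)) \<partial>(lborel :: (real^'d) measure))"
    by (simp add: vec_prod_Basis)
  also have "\<dots> = (\<integral>x. (\<Prod>b\<in>Basis. f (axis_index b) (x b)) \<partial>(\<Pi>\<^sub>M b\<in>(Basis::(real^'d) set). lborel))"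
    by (subst lborel_eq, subst integral_distr) (auto intro!: Bochner_Integration.integral_cong prod.cong)
  also have "\<dots> = (\<Prod>b\<in>(Basis::(real^'d) set). \<integral>t. f (axis_index b) t \<partial>lborel)"
    by (intro product_integral_prod f) auto
  finally show ?thesis using vec_prod_Basis_const[of "\<lambda>i. \<integral>t. f i t \<partial>lborel"] by simp
qed

lemma integrable_lborel_vec_prod:
  fixes f :: "'d::finite \<Rightarrow> real \<Rightarrow> real"
  assumes f: "\<And>i. integrable lborel (f i)"
  shows "integrable (lborel :: (real^'d) measure) (\<lambda>x. \<Prod>i\<in>UNIV. f i (x $ i))"
proof -
  interpret product_sigma_finite "\<lambda>b::real^'d. lborel :: real measure" ..
  have [measurable]: "\<And>i. f i \<in> borel_measurable borel"
    using f by (auto dest: borel_measurable_integrable)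
  have "integrable (\<Pi>\<^sub>M b\<in>(Basis::(real^'d) set). lborel) (\<lambda>x. \<Prod>b\<in>Basis. f (axis_index b) (x b))"
    by (intro product_integrable_prod f) auto
  then have "integrable (lborel :: (real^'d) measure) (\<lambda>x. \<Prod>b\<in>Basis. f (axis_index b) (x \<bullet> b))"
    by (subst lborel_eq, subst integrable_distr_eq) 
      (auto intro!: Bochner_Integration.integrable_cong[THEN iffD1, rotated -1] prod.cong)
  then show ?thesis by (simp add: vec_prod_Basis)
qed

section \<open>Uniform distribution on the half-open cube and volumes of boxes\<close>

abbreviation cube_measure :: "(real ^ 'd) measure" where
  "cube_measure \<equiv> restrict_space lborel ho_unit_cube"

lemma ho_unit_cube_borel [measurable]: "ho_unit_cube \<in> sets borel"
  unfolding ho_unit_cube_def by measurable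

lemma indicator_coordinatewise:
  "indicator {z::real^'d. \<forall>i. z $ i \<in> S i} z = (\<Prod>i\<in>UNIV. indicator (S i) (z $ i) :: real)"
  by (auto simp: indicator_def)

text \<open>The indicator of a product set is the product of the indicators of its sides, so the
  product rule for integrable functions gives measurability, finiteness and the volume at
  once.\<close>

lemma measure_coordinatewise:
  fixes S :: "'d::finite \<Rightarrow> real set"
  assumes S: "\<And>i. S i \<in> sets lborel" "\<And>i. emeasure lborel (S i) < \<infinity>"
  shows "measure lborel {z::real^'d. \<forall>i. z $ i \<in> S i} = (\<Prod>i\<in>UNIV. measure lborel (S i))"
    and "{z::real^'d. \<forall>i. z $ i \<in> S i} \<in> sets lborel"
    and "emeasure lborel {z::real^'d. \<forall>i. z $ i \<in> S i} < \<infinity>"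
proof -
  let ?A = "{z::real^'d. \<forall>i. z $ i \<in> S i}"
  have i: "integrable lborel (indicator (S i) :: real \<Rightarrow> real)" for i
    using S by (simp add: integrable_indicator_iff)
  have "integrable lborel (indicator ?A :: _ \<Rightarrow> real)"
    unfolding indicator_coordinatewise[abs_def] by (rule integrable_lborel_vec_prod[OF i])
  then show "?A \<in> sets lborel" "emeasure lborel ?A < \<infinity>" 
    by (simp_all add: integrable_indicator_iff)
  have "measure lborel ?A = (\<integral>x. indicator ?A x \<partial>lborel)" by simp
  also have "\<dots> = (\<Prod>i\<in>UNIV. measure lborel (S i))"
    unfolding indicator_coordinatewise[abs_def]
    by (subst integral_lborel_vec_prod[OF i]) simp
  finally show "measure lborel ?A = (\<Prod>i\<in>UNIV. measure lborel (S i))" .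
qed

lemma measure_ho_box:
  fixes x y :: "real ^ 'd"
  assumes "\<And>i. x $ i \<le> y $ i"
  shows "measure lborel (ho_box x y) = (\<Prod>i\<in>UNIV. y $ i - x $ i)"
    and "ho_box x y \<in> sets borel"
proof -
  have eq: "ho_box x y = {z. \<forall>i. z $ i \<in> {x $ i..<y $ i}}"
    by (auto simp: ho_box_def)
  show "measure lborel (ho_box x y) = (\<Prod>i\<in>UNIV. y $ i - x $ i)"
    unfolding eq by (subst measure_coordinatewise) (use assms in auto)
  show "ho_box x y \<in> sets borel"
    unfolding ho_box_def by measurable
qed

lemma ho_unit_cube_eq: "ho_unit_cube = ho_box 0 1"
  by (auto simp: ho_unit_cube_def ho_box_def)

lemma prob_space_cube_measure: "prob_space (cube_measure :: (real ^ 'd) measure)"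
proof
  have "emeasure lborel (ho_unit_cube :: (real ^ 'd) set) < \<infinity>"
    by (rule emeasure_bounded_finite, rule bounded_subset[of "cbox 0 1"])
      (auto simp: ho_unit_cube_def mem_box_cart less_imp_le)
  then have "emeasure lborel (ho_unit_cube :: (real ^ 'd) set) = measure lborel (ho_unit_cube :: (real ^ 'd) set)"
    by (simp add: emeasure_eq_ennreal_measure less_top)
  also have "\<dots> = 1"
    unfolding ho_unit_cube_eq by (subst measure_ho_box) auto
  finally show "emeasure cube_measure (space (cube_measure :: (real ^ 'd) measure)) = 1"
    by (simp add: space_restrict_space emeasure_restrict_space)
qed

subsection \<open>Greedy sequences for a family of test sets\<close>

text \<open>One setting for all three discrepancies: \<open>w\<close> stands for the corner or pair
  of corners that fixes a test set. Joint measurability is what Fubini needs, and \<open>sub\<close>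
  makes the volume of \<open>B w\<close> equal to the probability that a uniform point of the cube
  hits it.\<close>

locale test_sets = finite_measure M for M :: "'w measure" +
  fixes B :: "'w \<Rightarrow> (real ^ 'd) set"
  assumes meas: "{p \<in> space (M \<Otimes>\<^sub>M cube_measure). snd p \<in> B (fst p)} \<in> sets (M \<Otimes>\<^sub>M cube_measure)"
    and sub: "\<And>w. w \<in> space M \<Longrightarrow> B w \<subseteq> ho_unit_cube"
begin

sublocale Q: prob_space "cube_measure :: (real ^ 'd) measure" by (rule prob_space_cube_measure)
sublocale MQ: pair_sigma_finite M "cube_measure :: (real ^ 'd) measure" ..

lemma prob_cube [simp]: "measure cube_measure (ho_unit_cube :: (real ^ 'd) set) = 1"
  using Q.prob_space by (simp add: space_restrict_space)

lemma finite_MQ: "finite_measure (M \<Otimes>\<^sub>M (cube_measure :: (real ^ 'd) measure))"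
  by (rule finite_measure_pair_measure) unfold_locales

definition vol :: "'w \<Rightarrow> real" where "vol w = measure lebesgue (B w)"

definition hit :: "'w \<Rightarrow> real ^ 'd \<Rightarrow> real" where "hit w z = indicator (B w) z"

definition err :: "nat \<Rightarrow> (nat \<Rightarrow> real ^ 'd) \<Rightarrow> 'w \<Rightarrow> real" where
  "err N X w = local_disc N (B w) X"

lemma hit_measurable [measurable]:
  "(\<lambda>(w, z). hit w z) \<in> borel_measurable (M \<Otimes>\<^sub>M cube_measure)"
proof -
  have "(\<lambda>p. indicator {p \<in> space (M \<Otimes>\<^sub>M cube_measure). snd p \<in> B (fst p)} p :: real) 
     \<in> borel_measurable (M \<Otimes>\<^sub>M cube_measure)"
    using meas by measurable
  then show ?thesis
    by (rule measurable_cong[THEN iffD1, rotated]) (auto simp: hit_def indicator_def)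
qed

lemma hit_measurable_swap [measurable]:
  "(\<lambda>(z, w). hit w z) \<in> borel_measurable (cube_measure \<Otimes>\<^sub>M M)"
  using measurable_pair_swap[OF hit_measurable] by (simp add: case_prod_beta')

lemma hit_measurable_left [measurable]:
  "z \<in> ho_unit_cube \<Longrightarrow> (\<lambda>w. hit w z) \<in> borel_measurable M"
  using measurable_compose[OF measurable_Pair2' hit_measurable, of z] 
  by (simp add: space_restrict_space)

lemma hit_measurable_right [measurable]:
  "w \<in> space M \<Longrightarrow> hit w \<in> borel_measurable cube_measure"
  using measurable_compose[OF measurable_Pair1' hit_measurable, of w] by simp

lemma sets_B: assumes "w \<in> space M" shows "B w \<in> sets cube_measure" "B w \<in> sets borel"
proof -
  have "hit w -` {1} \<inter> space cube_measure \<in> sets cube_measure"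
    using hit_measurable_right[OF assms] by (rule measurable_sets) auto
  moreover have "hit w -` {1} \<inter> space cube_measure = B w"
    using sub[OF assms] by (auto simp: hit_def indicator_def space_restrict_space split: if_splits)
  ultimately show "B w \<in> sets cube_measure" by simp
  then show "B w \<in> sets borel"
    by (subst (asm) sets_restrict_space_iff) auto
qed

lemma vol_eq: assumes "w \<in> space M" shows "vol w = (\<integral>z. hit w z \<partial>cube_measure)"
  using sets_B[OF assms] sub[OF assms]
  by (simp add: vol_def hit_def[abs_def] measure_restrict_space space_restrict_space Int_absorb2)

lemma vol_measurable [measurable]: "vol \<in> borel_measurable M"
  by (subst measurable_cong[OF vol_eq], assumption) measurable

lemma vol_bounds: assumes "w \<in> space M" shows "0 \<le> vol w" "vol w \<le> 1"
proof -
  show "0 \<le> vol w" by (simp add: vol_def)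
  show "vol w \<le> 1" using sets_B[OF assms] sub[OF assms] Q.prob_le_1[of "B w"]
    by (simp add: vol_def measure_restrict_space)
qed

lemma hit_bounds: "0 \<le> hit w z" "hit w z \<le> 1" "hit w z ^ 2 = hit w z"
  by (auto simp: hit_def indicator_def)

lemma err_eq: "err N X w = (\<Sum>n\<in>{1..N}. hit w (X n)) - real N * vol w"
proof -
  have "real (card {n \<in> {1..N}. X n \<in> B w}) = (\<Sum>n\<in>{1..N}. hit w (X n))"
    unfolding hit_def by (simp add: indicator_def sum.If_cases Int_def)
  then show ?thesis by (simp add: err_def local_disc_def vol_def)
qed

lemma err_Suc: "err (Suc N) (X(Suc N := y)) w = err N X w + (hit w y - vol w)"
  by (simp add: err_eq algebra_simps)

lemma err_bound: assumes "w \<in> space M" shows "\<bar>err N X w\<bar> \<le> real N"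
proof -
  have "0 \<le> (\<Sum>n\<in>{1..N}. hit w (X n))" "(\<Sum>n\<in>{1..N}. hit w (X n)) \<le> real N"
    using hit_bounds sum_bounded_above[of "{1..N}" "\<lambda>n. hit w (X n)" 1] by (auto intro: sum_nonneg)
  moreover have "0 \<le> real N * vol w" "real N * vol w \<le> real N"
    using vol_bounds[OF assms] by (auto intro: mult_left_le)
  ultimately show ?thesis by (simp add: err_eq)
qed

lemma err_measurable: 
  assumes "\<And>n. n \<in> {1..N} \<Longrightarrow> X n \<in> ho_unit_cube"
  shows "err N X \<in> borel_measurable M"
  unfolding err_eq[abs_def] using assms by measurable

lemma integrable_err_sq: 
  assumes "\<And>n. n \<in> {1..N} \<Longrightarrow> X n \<in> ho_unit_cube"
  shows "integrable M (\<lambda>w. (err N X w)\<^sup>2)"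
proof (rule integrable_const_bound[where B = "(real N)\<^sup>2"])
  show "AE w in M. norm ((err N X w)\<^sup>2) \<le> (real N)\<^sup>2"
    using err_bound[of _ N X] by (auto intro!: AE_I2 simp flip: abs_le_square_iff)
  show "(\<lambda>w. (err N X w)\<^sup>2) \<in> borel_measurable M"
    using err_measurable[OF assms] by measurable
qed

lemma integrable_vol: "integrable M (\<lambda>w. vol w - (vol w)\<^sup>2)"
proof (rule integrable_const_bound[where B = 1])
  show "AE w in M. norm (vol w - (vol w)\<^sup>2) \<le> 1"
  proof (rule AE_I2)
    fix w assume "w \<in> space M"
    note v = vol_bounds[OF this]
    then have "0 \<le> vol w * (1 - vol w)" "vol w * (1 - vol w) \<le> 1"
      by (auto intro: mult_nonneg_nonneg mult_le_one)
    then show "norm (vol w - (vol w)\<^sup>2) \<le> 1" by (simp add: power2_eq_square algebra_simps)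
  qed
qed measurable

theorem greedy_step:
  assumes X: "\<And>n. n \<ge> 1 \<Longrightarrow> X n \<in> ho_unit_cube"
    and min: "\<And>y. y \<in> ho_unit_cube \<Longrightarrow> 
       (\<integral>w. (err (Suc N) X w)\<^sup>2 \<partial>M) \<le> (\<integral>w. (err (Suc N) (X(Suc N := y)) w)\<^sup>2 \<partial>M)"
  shows "(\<integral>w. (err (Suc N) X w)\<^sup>2 \<partial>M) \<le> (\<integral>w. (err N X w)\<^sup>2 \<partial>M) + (\<integral>w. vol w - (vol w)\<^sup>2 \<partial>M)"
proof -
  let ?f = "\<lambda>w y. (err N X w + (hit w y - vol w))\<^sup>2"
  interpret F: finite_measure "M \<Otimes>\<^sub>M (cube_measure :: (real ^ 'd) measure)" by (rule finite_MQ)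
  have [measurable]: "err N X \<in> borel_measurable M" using X by (intro err_measurable) auto
  have "integrable (M \<Otimes>\<^sub>M cube_measure) (case_prod ?f)"
  proof (rule F.integrable_const_bound[where B = "(real N + 1)\<^sup>2"])
    show "AE p in M \<Otimes>\<^sub>M cube_measure. norm (case_prod ?f p) \<le> (real N + 1)\<^sup>2"
    proof (rule AE_I2, clarsimp simp: space_pair_measure)
      fix w y assume w: "w \<in> space M"
      have "\<bar>err N X w + (hit w y - vol w)\<bar> \<le> \<bar>real N + 1\<bar>"
        using err_bound[OF w, of N X] vol_bounds[OF w] hit_bounds[of w y] by linarith
      then show "(err N X w + (hit w y - vol w))\<^sup>2 \<le> (real N + 1)\<^sup>2"
        using abs_le_square_iff by force
    qed
  qed measurable
  note int = this
  \<comment> \<open>A constant equals its own average over the probability measure on the cube; the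
    minimality assumption can then be applied under the integral.\<close>
  have "(\<integral>w. (err (Suc N) X w)\<^sup>2 \<partial>M) = (\<integral>y. (\<integral>w. (err (Suc N) X w)\<^sup>2 \<partial>M) \<partial>(cube_measure :: (real ^ 'd) measure))"
    using Q.prob_space by (simp add: space_restrict_space)
  also have "\<dots> \<le> (\<integral>y. (\<integral>w. ?f w y \<partial>M) \<partial>cube_measure)"
    by (rule integral_mono) (use min MQ.integrable_snd[OF int] in \<open>auto simp: err_Suc space_restrict_space\<close>)
  also have "\<dots> = (\<integral>w. (\<integral>y. ?f w y \<partial>cube_measure) \<partial>M)"
    by (rule MQ.Fubini_integral[OF int])
  also have "\<dots> = (\<integral>w. (err N X w)\<^sup>2 + (vol w - (vol w)\<^sup>2) \<partial>M)"
  proof (intro Bochner_Integration.integral_cong refl)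
    fix w assume w: "w \<in> space M"
    have ih: "integrable cube_measure (hit w)"
      using w hit_bounds by (intro Q.integrable_const_bound[where B = 1]) auto
    \<comment> \<open>\<open>a\<close> collects the part that does not depend on \<open>y\<close>.
      As \<open>hit\<close> takes only the values 0 and 1, its square is itself and the integrand
      becomes affine in \<open>hit\<close>.\<close>
    define a where "a = err N X w - vol w"
    have "?f w y = a\<^sup>2 + (2 * a + 1) * hit w y" for y
      using hit_bounds(3)[of w y] by (simp add: a_def power2_eq_square algebra_simps)
    then have "(\<integral>y. ?f w y \<partial>cube_measure) = a\<^sup>2 + (2 * a + 1) * vol w"
      using ih w by (simp add: vol_eq Q.prob_space)
    \<comment> \<open>With \<open>e\<close> the old error and \<open>v\<close> the volume, the mixed
      terms in \<open>e * v\<close> cancel, because the jump \<open>hit w y - v\<close> has mean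
      zero over \<open>y\<close>.\<close>
    then show "(\<integral>y. ?f w y \<partial>cube_measure) = (err N X w)\<^sup>2 + (vol w - (vol w)\<^sup>2)"
      by (simp add: a_def power2_eq_square algebra_simps)
  qed
  also have "\<dots> = (\<integral>w. (err N X w)\<^sup>2 \<partial>M) + (\<integral>w. vol w - (vol w)\<^sup>2 \<partial>M)"
    using X by (intro Bochner_Integration.integral_add integrable_err_sq integrable_vol) auto
  finally show ?thesis .
qed

text \<open>By linearity the deviation of the averages from their limit is the integral of
  \<open>G w * err N X w\<close> divided by \<open>N\<close>. A linear bound on the integrated
  squared error makes this of order \<open>1 / sqrt N\<close>.\<close>

theorem test_function_average:
  assumes X: "\<And>n. n \<ge> 1 \<Longrightarrow> X n \<in> ho_unit_cube"
    and bound: "\<And>N. N \<ge> k \<Longrightarrow> (\<integral>w. (err N X w)\<^sup>2 \<partial>M) \<le> K * real N"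
    and G [measurable]: "G \<in> borel_measurable M" and GC: "\<And>w. w \<in> space M \<Longrightarrow> \<bar>G w\<bar> \<le> C"
  shows "(\<lambda>N. (\<Sum>n\<in>{1..N}. \<integral>w. G w * hit w (X n) \<partial>M) / real N)
    \<longlonglongrightarrow> (\<integral>z. (\<integral>w. G w * hit w z \<partial>M) \<partial>cube_measure)"
proof -
  interpret F: finite_measure "M \<Otimes>\<^sub>M (cube_measure :: (real ^ 'd) measure)" by (rule finite_MQ)
  \<comment> \<open>\<open>C\<close> may be negative if the space of \<open>M\<close> is empty, so
    it is replaced by a nonnegative bound.\<close>
  define C' where "C' = max C 0"
  have C': "0 \<le> C'" "\<And>w. w \<in> space M \<Longrightarrow> \<bar>G w\<bar> \<le> C'" using GC by (auto simp: C'_def le_max_iff_disj)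
  let ?I = "\<integral>z. (\<integral>w. G w * hit w z \<partial>M) \<partial>cube_measure"
  have Gh: "\<bar>G w * hit w z\<bar> \<le> C'" if "w \<in> space M" for w z
    using C' that hit_bounds[of w z] mult_mono[of "\<bar>G w\<bar>" C' "hit w z" 1] by (simp add: abs_mult)
  have int: "integrable (M \<Otimes>\<^sub>M cube_measure) (\<lambda>(w, z). G w * hit w z)"
  proof (rule F.integrable_const_bound[where B = C'])
    show "AE p in M \<Otimes>\<^sub>M cube_measure. norm (case p of (w, z) \<Rightarrow> G w * hit w z) \<le> C'"
      using Gh by (intro AE_I2) (auto simp: space_pair_measure)
  qed measurable
  have intn: "integrable M (\<lambda>w. G w * hit w z)" if "z \<in> ho_unit_cube" for z
    using Gh that by (intro integrable_const_bound[where B = C'] AE_I2) auto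
  have intv: "integrable M (\<lambda>w. G w * vol w)"
  proof (intro integrable_const_bound[where B = C'] AE_I2)
    fix w assume "w \<in> space M" 
    then show "norm (G w * vol w) \<le> C'"
      using C' vol_bounds[of w] mult_mono[of "\<bar>G w\<bar>" C' "vol w" 1] by (simp add: abs_mult)
  qed measurable
  have I: "?I = (\<integral>w. G w * vol w \<partial>M)"
    unfolding MQ.Fubini_integral[OF int] by (intro Bochner_Integration.integral_cong) (auto simp: vol_eq)
  \<comment> \<open>\<open>D\<close> is what remains when both terms of the majorant
    \<open>?b\<close> below are integrated and \<open>sqrt N\<close> is factored out.\<close>
  define D where "D = C' * (measure M (space M) + K) / 2"
  have key: "\<bar>(\<Sum>n\<in>{1..N}. \<integral>w. G w * hit w (X n) \<partial>M) / real N - ?I\<bar> \<le> D / sqrt (real N)"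
    if N: "N \<ge> k" "N \<ge> 1" for N
  proof -
    have [measurable]: "err N X \<in> borel_measurable M" using X by (intro err_measurable) auto
    have s: "sqrt (real N) > 0" "sqrt (real N) * sqrt (real N) = real N" using N by auto
    \<comment> \<open>The majorant replaces Cauchy-Schwarz:
      \<open>e \<le> s / 2 + e^2 / (2 * s)\<close> holds pointwise by AM-GM, and the choice
      \<open>s = sqrt N\<close> balances the terms so that both integrate to order
      \<open>sqrt N\<close>.\<close>
    let ?b = "\<lambda>w. C' / 2 * sqrt (real N) + C' / (2 * sqrt (real N)) * (err N X w)\<^sup>2"
    have ib: "integrable M ?b"
      using X by (intro Bochner_Integration.integrable_add integrable_mult_right integrable_err_sq) auto
    have pw: "\<bar>G w * err N X w\<bar> \<le> ?b w" if "w \<in> space M" for w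
    proof -
      define e s where "e = \<bar>err N X w\<bar>" and "s = sqrt (real N)"
      have sp: "s > 0" using s by (simp add: s_def)
      have "0 \<le> (s - e)\<^sup>2" by simp
      then have "e * (2 * s) \<le> s * s + e\<^sup>2" by (simp add: power2_eq_square algebra_simps)
      then have "e \<le> s / 2 + e\<^sup>2 / (2 * s)" using sp
        by (simp add: field_simps)
      then have "C' * e \<le> C' * (s / 2 + e\<^sup>2 / (2 * s))" using C' by (intro mult_left_mono)
      moreover have "\<bar>G w * err N X w\<bar> \<le> C' * e"
        unfolding abs_mult e_def using C' that by (intro mult_right_mono) auto
      ultimately show ?thesis by (simp add: e_def s_def algebra_simps)
    qed
    have iG: "integrable M (\<lambda>w. G w * err N X w)"
      using pw by (intro Bochner_Integration.integrable_bound[OF ib] AE_I2) force+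
    have "(\<Sum>n\<in>{1..N}. \<integral>w. G w * hit w (X n) \<partial>M) - real N * ?I = 
        (\<integral>w. (\<Sum>n\<in>{1..N}. G w * hit w (X n)) - real N * (G w * vol w) \<partial>M)"
      unfolding I using X
      by (subst Bochner_Integration.integral_diff)
         (auto intro!: intn intv Bochner_Integration.integral_sum[symmetric])
    also have "\<dots> = (\<integral>w. G w * err N X w \<partial>M)"
      by (simp add: err_eq algebra_simps sum_distrib_left)
    finally have "\<bar>(\<Sum>n\<in>{1..N}. \<integral>w. G w * hit w (X n) \<partial>M) - real N * ?I\<bar> = \<bar>\<integral>w. G w * err N X w \<partial>M\<bar>" by simp
    also have "\<dots> \<le> (\<integral>w. \<bar>G w * err N X w\<bar> \<partial>M)" by (rule integral_abs_bound)
    also have "\<dots> \<le> (\<integral>w. ?b w \<partial>M)"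
      using pw iG ib by (intro integral_mono) auto
    also have "\<dots> = C' / 2 * sqrt (real N) * measure M (space M) + C' / (2 * sqrt (real N)) * (\<integral>w. (err N X w)\<^sup>2 \<partial>M)"
      using integrable_err_sq[of N X] X by simp
    also have "\<dots> \<le> C' / 2 * sqrt (real N) * measure M (space M) + C' / (2 * sqrt (real N)) * (K * real N)"
      using bound[OF N(1)] C' s by (intro add_left_mono mult_left_mono) auto
    also have "\<dots> = D * sqrt (real N)"
      using s by (simp add: D_def field_simps)
    finally have "\<bar>(\<Sum>n\<in>{1..N}. \<integral>w. G w * hit w (X n) \<partial>M) - real N * ?I\<bar> / real N \<le> D * sqrt (real N) / real N"
      by (intro divide_right_mono) auto
    also have "\<dots> = D / sqrt (real N)" using s(1) s(2)[symmetric] N by (simp add: field_simps)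
    also have "\<bar>(\<Sum>n\<in>{1..N}. \<integral>w. G w * hit w (X n) \<partial>M) - real N * ?I\<bar> / real N =
      \<bar>((\<Sum>n\<in>{1..N}. \<integral>w. G w * hit w (X n) \<partial>M) - real N * ?I) / real N\<bar>" by simp
    also have "((\<Sum>n\<in>{1..N}. \<integral>w. G w * hit w (X n) \<partial>M) - real N * ?I) / real N = 
        (\<Sum>n\<in>{1..N}. \<integral>w. G w * hit w (X n) \<partial>M) / real N - ?I" using N by (simp add: diff_divide_distrib)
    finally show ?thesis .
  qed
  have "(\<lambda>N. D / sqrt (real N)) \<longlonglongrightarrow> 0"
    by (intro tendsto_divide_0[OF tendsto_const] filterlim_at_top_imp_at_infinity
        filterlim_compose[OF sqrt_at_top filterlim_real_sequentially])
  then have "(\<lambda>N. (\<Sum>n\<in>{1..N}. \<integral>w. G w * hit w (X n) \<partial>M) / real N - ?I) \<longlonglongrightarrow> 0"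
    by (rule Lim_null_comparison[rotated])
      (use key in \<open>auto simp: eventually_sequentially intro!: exI[of _ "max k 1"]\<close>)
  then show ?thesis by (simp add: LIM_zero_iff)
qed

end

subsection \<open>Uniform distribution from lower bounds\<close>

text \<open>The lower half of convergence: the lower limit of the frequency of the box is at least
  its volume. Only this half is derived from the test functions.\<close>

definition eventually_covers :: "(nat \<Rightarrow> real ^ 'd) \<Rightarrow> real ^ 'd \<Rightarrow> real ^ 'd \<Rightarrow> bool" where
  "eventually_covers X x y \<longleftrightarrow> (\<forall>\<epsilon>>0. \<forall>\<^sub>F N in sequentially.
     measure lborel (ho_box x y) - \<epsilon> < real (card {n \<in> {1..N}. X n \<in> ho_box x y}) / real N)"

lemma card_eq_sum_indicator:
  "real (card {n \<in> {1..N::nat}. X n \<in> C}) = (\<Sum>n\<in>{1..N}. indicator C (X n))"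
  by (simp add: indicator_def sum.If_cases Int_def)

text \<open>Cutting every side of the cube at \<open>x\<^sub>i\<close> and \<open>y\<^sub>i\<close> yields \<open>3\<^sup>d\<close> boxes whose counts add up to \<open>N\<close>
  and whose volumes add up to 1, so lower bounds for all of them give an upper bound for each.\<close>

lemma uniformly_distributed_if_covers:
  fixes X :: "nat \<Rightarrow> real ^ 'd"
  assumes X: "\<And>n. n \<ge> 1 \<Longrightarrow> X n \<in> ho_unit_cube"
    and lower: "\<And>x y. x \<in> unit_cube \<Longrightarrow> y \<in> unit_cube \<Longrightarrow> (\<And>i. x $ i < y $ i) \<Longrightarrow> eventually_covers X x y"
  shows "uniformly_distributed_mod1 X"
proof -
  \<comment> \<open>Pieces of the subdivision below can have a side of length zero; such a box is
    empty and is covered trivially.\<close>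
  have lower': "eventually_covers X x y"
    if xy: "x \<in> unit_cube" "y \<in> unit_cube" "x \<le> y" for x y :: "real ^ 'd"
  proof (cases "\<forall>i. x $ i < y $ i")
    case True
    then show ?thesis using lower xy by blast
  next
    case False
    then obtain i where i: "x $ i = y $ i"
      using xy(3) by (auto simp: less_eq_vec_def not_less intro: antisym)
    have "z \<notin> ho_box x y" for z using i by (auto simp: ho_box_def intro!: exI[of _ i])
    then have "ho_box x y = {}" by blast
    then show ?thesis by (simp add: eventually_covers_def)
  qed
  have "(\<lambda>N. real (card {n \<in> {1..N}. X n \<in> ho_box x y}) / real N) \<longlonglongrightarrow> measure lebesgue (ho_box x y)"
    if x: "x \<in> unit_cube" and y: "y \<in> unit_cube" and xy: "x \<le> y" for x y :: "real ^ 'd"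
  proof -
    \<comment> \<open>The cut points of side \<open>i\<close> are 0, \<open>x $ i\<close>,
      \<open>y $ i\<close> and 1, at indices 0, 1, 2 and 3. Piece \<open>j\<close> runs from
      \<open>p i j\<close> to \<open>p i (Suc j)\<close>, so a function \<open>g\<close> into
      \<open>J\<close> names one box of the subdivision; the constant 1 names the box from
      \<open>x\<close> to \<open>y\<close>.\<close>
    define p where "p i j = (if j = 0 then 0 else if j = 1 then x $ i else if j = 2 then y $ i else 1)"
      for i :: 'd and j :: nat
    define J where "J = {0, 1, 2::nat}"
    define Gs where "Gs = (PiE UNIV (\<lambda>_. J) :: ('d \<Rightarrow> nat) set)"
    define lo hi where "lo g = (\<chi> i. p i (g i))" and "hi g = (\<chi> i. p i (Suc (g i)))" for g
    have fin: "finite Gs" unfolding Gs_def J_def by (intro finite_PiE) auto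
    have p01: "0 \<le> p i j" "p i j \<le> 1" "p i j \<le> p i (Suc j)" for i j
      using x y xy by (auto simp: p_def unit_cube_def less_eq_vec_def)
    have mem: "lo g \<in> unit_cube" "hi g \<in> unit_cube" "lo g \<le> hi g" for g
      using p01 by (auto simp: lo_def hi_def unit_cube_def less_eq_vec_def)
    have ones: "(\<lambda>_. 1) \<in> Gs" by (auto simp: Gs_def J_def)
    have lo1: "lo (\<lambda>_. 1) = x" "hi (\<lambda>_. 1) = y" by (auto simp: lo_def hi_def p_def vec_eq_iff)
    have Jsum: "(\<Sum>j\<in>J. q j) = q 0 + q 1 + q 2" for q :: "nat \<Rightarrow> real"
      by (simp add: J_def)
    have part: "(\<Sum>g\<in>Gs. indicator (ho_box (lo g) (hi g)) z) = (1::real)" if "z \<in> ho_unit_cube" for z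
    proof -
      have "(\<Sum>j\<in>J. indicator {p i j..<p i (Suc j)} (z $ i)) = (1::real)" for i
        using that x y xy p01[of i 0] p01[of i 1] p01[of i 2]
        unfolding Jsum by (auto simp: p_def indicator_def ho_unit_cube_def)
      \<comment> \<open>In each direction exactly one piece contains \<open>z $ i\<close>. Expanding
        the product of these sums by distributivity turns it into a sum over all boxes.\<close>
      then have "1 = (\<Prod>i\<in>UNIV. \<Sum>j\<in>J. indicator {p i j..<p i (Suc j)} (z $ i) :: real)" by simp
      also have "\<dots> = (\<Sum>g\<in>Gs. \<Prod>i\<in>UNIV. indicator {p i (g i)..<p i (Suc (g i))} (z $ i))"
        unfolding Gs_def by (rule prod_sum_PiE) (auto simp: J_def)
      also have "\<dots> = (\<Sum>g\<in>Gs. indicator (ho_box (lo g) (hi g)) z)"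
        unfolding indicator_coordinatewise[symmetric]
        by (simp add: ho_box_def lo_def hi_def)
      finally show ?thesis by simp
    qed
    have vols: "(\<Sum>g\<in>Gs. measure lborel (ho_box (lo g) (hi g))) = 1"
    proof -
      have "(\<Sum>g\<in>Gs. measure lborel (ho_box (lo g) (hi g))) = (\<Sum>g\<in>Gs. \<Prod>i\<in>UNIV. p i (Suc (g i)) - p i (g i))"
        using mem by (intro sum.cong refl, subst measure_ho_box) (auto simp: less_eq_vec_def lo_def hi_def)
      also have "\<dots> = (\<Prod>i\<in>UNIV. \<Sum>j\<in>J. p i (Suc j) - p i j)"
        unfolding Gs_def by (rule prod_sum_PiE[symmetric]) (auto simp: J_def)
      also have "\<dots> = 1" by (simp add: J_def p_def)
      finally show ?thesis .
    qed
    define c where "c g N = real (card {n \<in> {1..N}. X n \<in> ho_box (lo g) (hi g)}) / real N" for g N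
    define v where "v g = measure lborel (ho_box (lo g) (hi g))" for g
    have csum: "(\<Sum>g\<in>Gs. c g N) = 1" if "N \<ge> 1" for N
    proof -
      have "(\<Sum>g\<in>Gs. c g N) = (\<Sum>n\<in>{1..N}. \<Sum>g\<in>Gs. indicator (ho_box (lo g) (hi g)) (X n)) / real N"
        unfolding c_def sum_divide_distrib[symmetric] card_eq_sum_indicator by (subst sum.swap) simp
      also have "\<dots> = 1" using that X by (simp add: part)
      finally show ?thesis .
    qed
    have "(\<lambda>N. c (\<lambda>_. 1) N) \<longlonglongrightarrow> v (\<lambda>_. 1)"
    proof (rule tendstoI)
      fix \<epsilon> :: real assume \<epsilon>: "\<epsilon> > 0"
      \<comment> \<open>Counts and volumes have the same total, so an excess of the middle box is
        paid for by deficits of the others, each below \<eta>. Their number is one less than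
        \<open>card Gs\<close>, which keeps the excess below \<epsilon>.\<close>
      define \<eta> where "\<eta> = \<epsilon> / real (card Gs)"
      have cG: "card Gs > 0" using fin ones by (auto simp: card_gt_0_iff)
      have \<eta>: "\<eta> > 0" using \<epsilon> cG by (simp add: \<eta>_def)
      have "\<forall>\<^sub>F N in sequentially. \<forall>g\<in>Gs. v g - \<eta> < c g N"
        using fin lower'[OF mem] \<eta> by (auto simp: eventually_covers_def eventually_ball_finite_distrib v_def c_def)
      then show "\<forall>\<^sub>F N in sequentially. dist (c (\<lambda>_. 1) N) (v (\<lambda>_. 1)) < \<epsilon>"
        using eventually_ge_at_top[of 1]
      proof eventually_elim
        case (elim N)
        let ?o = "\<lambda>_::'d. 1::nat"
        have "c ?o N + (\<Sum>g\<in>Gs - {?o}. c g N) = v ?o + (\<Sum>g\<in>Gs - {?o}. v g)"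
          using csum[OF elim(2)] vols sum.remove[OF fin ones, of "\<lambda>g. c g N"] sum.remove[OF fin ones, of v]
          by (simp add: v_def)
        moreover have "(\<Sum>g\<in>Gs - {?o}. v g - \<eta>) \<le> (\<Sum>g\<in>Gs - {?o}. c g N)"
          using elim by (intro sum_mono) (auto intro: less_imp_le)
        moreover have "(\<Sum>g\<in>Gs - {?o}. v g - \<eta>) = (\<Sum>g\<in>Gs - {?o}. v g) - (real (card Gs) - 1) * \<eta>"
          using fin ones cG by (simp add: sum_subtractf card_Diff_singleton of_nat_diff Suc_le_eq)
        moreover have "v ?o - \<eta> < c ?o N" using elim ones by auto
        moreover have "real (card Gs) * \<eta> = \<epsilon>" using cG by (simp add: \<eta>_def)
        moreover have "1 * \<eta> \<le> real (card Gs) * \<eta>" using cG \<eta> by (intro mult_right_mono) auto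
        ultimately show ?case using \<eta> by (simp add: dist_real_def algebra_simps)
      qed
    qed
    then show ?thesis
      using measure_ho_box(2)[of x y] xy unfolding c_def v_def lo1 by (simp add: less_eq_vec_def)
  qed
  then show ?thesis using X by (simp add: uniformly_distributed_mod1_def)
qed

section \<open>Test functions squeezed between the indicators of a shrunk box and a box\<close>

definition shrunk_box :: "real \<Rightarrow> real ^ 'd \<Rightarrow> real ^ 'd \<Rightarrow> (real ^ 'd) set" where
  "shrunk_box \<delta> x y = ho_box (\<chi> i. x $ i + \<delta>) (\<chi> i. y $ i - \<delta>)"

context test_sets
begin

text \<open>The integral of \<open>G\<close> against \<open>hit\<close> serves as a Urysohn function
  on the cube: it is 1 on \<open>I\<close>, 0 off \<open>C\<close> and lies between 0 and 1.
  Boundedness of \<open>G\<close> is what the averaging theorem asks for; the sign of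
  \<open>G\<close> may vary.\<close>

definition separates :: "('w \<Rightarrow> real) \<Rightarrow> (real ^ 'd) set \<Rightarrow> (real ^ 'd) set \<Rightarrow> bool" where
  "separates G I C \<longleftrightarrow> G \<in> borel_measurable M \<and> (\<exists>c. \<forall>w\<in>space M. \<bar>G w\<bar> \<le> c) \<and>
     (\<forall>z\<in>ho_unit_cube. indicator I z \<le> (\<integral>w. G w * hit w z \<partial>M) \<and> (\<integral>w. G w * hit w z \<partial>M) \<le> indicator C z)"

text \<open>The frequency of the box is at least the average of a test function below its indicator.
  That average converges to an integral which is at least the volume of the shrunk box, and this
  volume is close to that of the box for small \<delta>.\<close>

lemma covers_if_separates:
  fixes X :: "nat \<Rightarrow> real ^ 'd"
  assumes X: "\<And>n. n \<ge> 1 \<Longrightarrow> X n \<in> ho_unit_cube"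
    and bound: "\<And>N. N \<ge> k \<Longrightarrow> (\<integral>w. (err N X w)\<^sup>2 \<partial>M) \<le> K * real N"
    and x: "x \<in> unit_cube" and y: "y \<in> unit_cube" and xy: "\<And>i. x $ i < y $ i"
    and sep: "\<And>\<delta>. 0 < \<delta> \<Longrightarrow> (\<And>i. 2 * \<delta> < y $ i - x $ i) \<Longrightarrow> \<exists>G. separates G (shrunk_box \<delta> x y) (ho_box x y)"
  shows "eventually_covers X x y"
  unfolding eventually_covers_def
proof (intro allI impI)
  fix \<epsilon> :: real assume \<epsilon>: "\<epsilon> > 0"
  \<comment> \<open>The volume of the shrunk box is continuous in \<delta>, with the volume of the
    full box as its limit at 0.\<close>
  have "((\<lambda>\<delta>. \<Prod>i\<in>UNIV. y $ i - x $ i - 2 * \<delta>) \<longlongrightarrow> (\<Prod>i\<in>UNIV. y $ i - x $ i - 2 * 0)) (at_right 0)"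
    by (intro tendsto_intros)
  then have "\<forall>\<^sub>F \<delta> in at_right 0. (\<Prod>i\<in>UNIV. y $ i - x $ i) - \<epsilon> / 2 < (\<Prod>i\<in>UNIV. y $ i - x $ i - 2 * \<delta>)"
    by (rule order_tendstoD) (use \<epsilon> in auto)
  moreover have "\<forall>\<^sub>F \<delta> in at_right 0. \<forall>i. 2 * \<delta> < y $ i - x $ i"
  proof (rule eventually_all_finite)
    fix i
    have "((\<lambda>\<delta>. 2 * \<delta>) \<longlongrightarrow> 2 * 0) (at_right (0::real))" by (intro tendsto_intros)
    then show "\<forall>\<^sub>F \<delta> in at_right 0. 2 * \<delta> < y $ i - x $ i"
      by (rule order_tendstoD) (use xy[of i] in auto)
  qed
  ultimately have "\<forall>\<^sub>F \<delta> in at_right 0. (\<Prod>i\<in>UNIV. y $ i - x $ i) - \<epsilon> / 2 < (\<Prod>i\<in>UNIV. y $ i - x $ i - 2 * \<delta>)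
      \<and> (\<forall>i. 2 * \<delta> < y $ i - x $ i) \<and> 0 < \<delta>"
    using eventually_at_right_less[of 0] by eventually_elim auto
  then obtain \<delta> where \<delta>: "(\<Prod>i\<in>UNIV. y $ i - x $ i) - \<epsilon> / 2 < (\<Prod>i\<in>UNIV. y $ i - x $ i - 2 * \<delta>)"
     "\<And>i. 2 * \<delta> < y $ i - x $ i" "0 < \<delta>"
    using eventually_happens[of _ "at_right (0::real)"] trivial_limit_at_right_real by blast
  obtain G c where G [measurable]: "G \<in> borel_measurable M" and c: "\<And>w. w \<in> space M \<Longrightarrow> \<bar>G w\<bar> \<le> c"
    and f: "\<And>z. z \<in> ho_unit_cube \<Longrightarrow> indicator (shrunk_box \<delta> x y) z \<le> (\<integral>w. G w * hit w z \<partial>M)"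
       "\<And>z. z \<in> ho_unit_cube \<Longrightarrow> (\<integral>w. G w * hit w z \<partial>M) \<le> indicator (ho_box x y) z"
    using sep[OF \<delta>(3,2)] unfolding separates_def by blast
  let ?f = "\<lambda>z. \<integral>w. G w * hit w z \<partial>M"
  have shr: "shrunk_box \<delta> x y \<in> sets borel" 
     "measure lborel (shrunk_box \<delta> x y) = (\<Prod>i\<in>UNIV. y $ i - x $ i - 2 * \<delta>)"
    unfolding shrunk_box_def using \<delta>(2,3)
    by (subst measure_ho_box; auto simp: algebra_simps less_imp_le)+
  have sub: "shrunk_box \<delta> x y \<subseteq> ho_unit_cube"
    using x y \<delta>(3) unfolding shrunk_box_def ho_box_def unit_cube_def ho_unit_cube_def
    by (auto; smt (verit))
  have Gh: "(\<lambda>z. ?f z) \<in> borel_measurable cube_measure"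
    by measurable
  have "measure lborel (shrunk_box \<delta> x y) = (\<integral>z. indicator (shrunk_box \<delta> x y) z \<partial>cube_measure)"
    using shr sub by (simp add: measure_restrict_space space_restrict_space Int_absorb2)
  also have "\<dots> \<le> (\<integral>z. ?f z \<partial>cube_measure)"
  proof (rule integral_mono)
    show "integrable cube_measure (indicator (shrunk_box \<delta> x y) :: _ \<Rightarrow> real)"
      using shr(1) by (intro Q.integrable_const_bound[where B = 1] AE_I2)
        (auto intro!: measurable_restrict_space1)
    show "integrable cube_measure ?f"
    proof (intro Q.integrable_const_bound[where B = 1] AE_I2 Gh)
      fix z :: "real ^ 'd" assume "z \<in> space cube_measure"
      then have z: "z \<in> ho_unit_cube" by (simp add: space_restrict_space)
      have "0 \<le> ?f z" by (rule order_trans[OF _ f(1)[OF z]]) simp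
      moreover have "?f z \<le> 1" by (rule order_trans[OF f(2)[OF z]]) (simp add: indicator_le_1)
      ultimately show "norm (?f z) \<le> 1" by simp
    qed
  qed (use f in \<open>auto simp: space_restrict_space\<close>)
  finally have big: "measure lborel (ho_box x y) - \<epsilon> < (\<integral>z. ?f z \<partial>cube_measure)"
    using \<delta>(1) shr(2) measure_ho_box(1)[of x y] xy \<epsilon> by (simp add: less_imp_le)
  have "(\<lambda>N. (\<Sum>n\<in>{1..N}. ?f (X n)) / real N) \<longlonglongrightarrow> (\<integral>z. ?f z \<partial>cube_measure)"
    by (rule test_function_average[OF X bound G c])
  then have "\<forall>\<^sub>F N in sequentially. measure lborel (ho_box x y) - \<epsilon> < (\<Sum>n\<in>{1..N}. ?f (X n)) / real N"
    by (rule order_tendstoD) (rule big)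
  then show "\<forall>\<^sub>F N in sequentially.
     measure lborel (ho_box x y) - \<epsilon> < real (card {n \<in> {1..N}. X n \<in> ho_box x y}) / real N"
  proof eventually_elim
    case (elim N)
    have "(\<Sum>n\<in>{1..N}. ?f (X n)) / real N \<le> real (card {n \<in> {1..N}. X n \<in> ho_box x y}) / real N"
      unfolding card_eq_sum_indicator using f(2) X by (intro divide_right_mono sum_mono) auto
    with elim show ?case by linarith
  qed
qed

text \<open>The test sets are averaged over a parameter set \<open>K\<close> of positive measure:
  points of \<open>I\<close> lie in all of them and points off \<open>C\<close> in none, so the mean
  of \<open>hit\<close> is 1 on \<open>I\<close> and 0 off \<open>C\<close>.\<close>

lemma separates_normalized_indicator:
  assumes [measurable]: "K \<in> sets M" and pos: "measure M K > 0"
    and B: "\<And>w. w \<in> K \<Longrightarrow> I \<subseteq> B w" "\<And>w. w \<in> K \<Longrightarrow> B w \<subseteq> C"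
  shows "separates (\<lambda>w. indicator K w / measure M K) I C"
proof -
  let ?f = "\<lambda>z. \<integral>w. indicator K w / measure M K * hit w z \<partial>M"
  have K: "(\<integral>w. indicator K w / measure M K \<partial>M) = 1"
    using pos by (simp add: sets.Int_space_eq2)
  have iK: "integrable M (\<lambda>w. indicator K w / measure M K)"
    by (simp add: integrable_indicator_iff less_top[symmetric])
  have "indicator I z \<le> ?f z \<and> ?f z \<le> indicator C z" if z: "z \<in> ho_unit_cube" for z
  proof -
    have le: "indicator K w / measure M K * hit w z \<le> indicator K w / measure M K" 
      and ge: "0 \<le> indicator K w / measure M K * hit w z" for w
      using hit_bounds[of w z] pos by (auto simp: indicator_def divide_right_mono)
    have i: "integrable M (\<lambda>w. indicator K w / measure M K * hit w z)"
    proof (rule Bochner_Integration.integrable_bound[OF iK])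
      show "(\<lambda>w. indicator K w / measure M K * hit w z) \<in> borel_measurable M" using z by measurable
      show "AE w in M. norm (indicator K w / measure M K * hit w z) \<le> norm (indicator K w / measure M K)"
        using pos hit_bounds[of _ z] by (intro AE_I2) (auto simp: indicator_def divide_right_mono)
    qed
    have "?f z \<le> 1" unfolding K[symmetric] using i iK le by (intro integral_mono) auto
    moreover have "0 \<le> ?f z" using ge by (intro integral_nonneg_AE AE_I2)
    moreover have "?f z = 0" if "z \<notin> C"
      using B(2) that by (intro Bochner_Integration.integral_eq_zero_AE AE_I2) (auto simp: hit_def indicator_def)
    moreover have "?f z = 1" if "z \<in> I"
      unfolding K[symmetric] using B(1) that
      by (intro Bochner_Integration.integral_cong) (auto simp: hit_def indicator_def)
    ultimately show ?thesis by (auto simp: indicator_def)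
  qed
  moreover have "(\<lambda>w. indicator K w / measure M K) \<in> borel_measurable M" by measurable
  moreover have "\<forall>w\<in>space M. \<bar>indicator K w / measure M K\<bar> \<le> 1 / measure M K"
    by (auto simp: indicator_def)
  ultimately show ?thesis unfolding separates_def by blast
qed

text \<open>The one-step inequality is summed up from \<open>k\<close>, and the resulting linear
  growth feeds the averaging theorem. The formula for \<open>L\<close> is asked only for points in
  the cube, where the squared error is known to be integrable.\<close>

theorem greedy_sequence:
  fixes X :: "nat \<Rightarrow> real ^ 'd" and L :: "nat \<Rightarrow> (nat \<Rightarrow> real ^ 'd) \<Rightarrow> real"
  assumes L: "\<And>N Y. (\<And>n. n \<in> {1..N} \<Longrightarrow> Y n \<in> ho_unit_cube) \<Longrightarrow> L N Y = sqrt (\<integral>w. (err N Y w)\<^sup>2 \<partial>M)"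
    and c: "(\<integral>w. vol w - (vol w)\<^sup>2 \<partial>M) = c"
    and sep: "\<And>x y \<delta>. x \<in> unit_cube \<Longrightarrow> y \<in> unit_cube \<Longrightarrow> 0 < \<delta> \<Longrightarrow> (\<And>i. 2 * \<delta> < y $ i - x $ i)
       \<Longrightarrow> \<exists>G. separates G (shrunk_box \<delta> x y) (ho_box x y)"
    and k: "k \<ge> 1"
    and X: "\<And>n. n \<ge> 1 \<Longrightarrow> X n \<in> ho_unit_cube"
    and greedy: "\<And>N. N \<ge> k \<Longrightarrow> X (Suc N) \<in> argmin_on ho_unit_cube (\<lambda>y. L (Suc N) (X(Suc N := y)))"
  shows "(\<forall>N\<ge>k. (L N X)\<^sup>2 \<le> max c ((L k X)\<^sup>2) * real (N - k + 1)) \<and> uniformly_distributed_mod1 X"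
proof -
  have L2: "(L N Y)\<^sup>2 = (\<integral>w. (err N Y w)\<^sup>2 \<partial>M)" if "\<And>n. n \<in> {1..N} \<Longrightarrow> Y n \<in> ho_unit_cube" for N Y
    by (subst L) (use that in auto)
  let ?m = "max c ((L k X)\<^sup>2)"
  have step: "(L (Suc N) X)\<^sup>2 \<le> (L N X)\<^sup>2 + c" if N: "N \<ge> k" for N
  proof -
    have "(\<integral>w. (err (Suc N) X w)\<^sup>2 \<partial>M) \<le> (\<integral>w. (err N X w)\<^sup>2 \<partial>M) + (\<integral>w. vol w - (vol w)\<^sup>2 \<partial>M)"
    proof (rule greedy_step[OF X])
      fix y :: "real ^ 'd" assume y: "y \<in> ho_unit_cube"
      then have "L (Suc N) (X(Suc N := X (Suc N))) \<le> L (Suc N) (X(Suc N := y))"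
        using greedy[OF N] by (auto simp: argmin_on_def)
      moreover have "L (Suc N) X = sqrt (\<integral>w. (err (Suc N) X w)\<^sup>2 \<partial>M)"
        using X by (intro L) auto
      moreover have "L (Suc N) (X(Suc N := y)) = sqrt (\<integral>w. (err (Suc N) (X(Suc N := y)) w)\<^sup>2 \<partial>M)"
        using X y by (intro L) auto
      ultimately show "(\<integral>w. (err (Suc N) X w)\<^sup>2 \<partial>M) \<le> (\<integral>w. (err (Suc N) (X(Suc N := y)) w)\<^sup>2 \<partial>M)"
        by simp
    qed auto
    moreover have "(L (Suc N) X)\<^sup>2 = (\<integral>w. (err (Suc N) X w)\<^sup>2 \<partial>M)" "(L N X)\<^sup>2 = (\<integral>w. (err N X w)\<^sup>2 \<partial>M)"
      using X by (intro L2; simp)+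
    ultimately show ?thesis by (simp add: c)
  qed
  have bound: "(L N X)\<^sup>2 \<le> ?m * real (N - k + 1)" if "N \<ge> k" for N
    using that
  proof (induction N rule: dec_induct)
    case base
    then show ?case by simp
  next
    case (step N)
    \<comment> \<open>Each step adds at most \<open>c\<close>, hence at most \<open>?m\<close>; the
      summand 1 in \<open>N - k + 1\<close> accounts for the starting value.\<close>
    have "(L (Suc N) X)\<^sup>2 \<le> ?m * real (N - k + 1) + ?m"
      using \<open>(L N X)\<^sup>2 \<le> _\<close> \<open>N \<ge> k\<close>[THEN \<open>\<And>N. N \<ge> k \<Longrightarrow> (L (Suc N) X)\<^sup>2 \<le> (L N X)\<^sup>2 + c\<close>] by linarith
    then show ?case using \<open>k \<le> N\<close> by (simp add: Suc_diff_le algebra_simps)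
  qed
  have m0: "0 \<le> ?m" by (simp add: le_max_iff_disj)
  have "(\<integral>w. (err N X w)\<^sup>2 \<partial>M) \<le> ?m * real N" if "N \<ge> k" for N
  proof -
    have "(\<integral>w. (err N X w)\<^sup>2 \<partial>M) = (L N X)\<^sup>2" using X by (intro L2[symmetric]) auto
    also have "\<dots> \<le> ?m * real (N - k + 1)" by (rule bound[OF that])
    \<comment> \<open>As \<open>k\<close> is at least 1, \<open>N - k + 1\<close> is at most
      \<open>N\<close>, which gives a bound proportional to \<open>N\<close>.\<close>
    also have "\<dots> \<le> ?m * real N" using k that m0 by (intro mult_left_mono) auto
    finally show ?thesis .
  qed
  then have "uniformly_distributed_mod1 X"
    using sep X by (intro uniformly_distributed_if_covers covers_if_separates) auto
  with bound show ?thesis by blast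
qed

end

subsection \<open>Integration over pairs of points\<close>

abbreviation param_measure :: "'w::euclidean_space set \<Rightarrow> 'w measure" where
  "param_measure A \<equiv> restrict_space lborel A"

text \<open>Lebesgue measure restricted to a bounded Borel set is finite, and joint measurability is
  inherited from the unrestricted Borel spaces along the inclusions.\<close>

lemma test_setsI:
  fixes A :: "'w::euclidean_space set" and B :: "'w \<Rightarrow> (real ^ 'd) set"
  assumes A: "A \<in> sets borel" "bounded A"
    and B: "{p. snd p \<in> B (fst p)} \<in> sets (borel \<Otimes>\<^sub>M borel)"
    and sub: "\<And>w. w \<in> A \<Longrightarrow> B w \<subseteq> ho_unit_cube"
  shows "test_sets (param_measure A) B"
proof -
  have "finite_measure (param_measure A)"
    using A emeasure_bounded_finite[OF A(2)]
    by (intro finite_measureI) (simp add: space_restrict_space emeasure_restrict_space less_top)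
  moreover have "{p \<in> space (param_measure A \<Otimes>\<^sub>M cube_measure). snd p \<in> B (fst p)}
      \<in> sets (param_measure A \<Otimes>\<^sub>M cube_measure)"
  proof -
    have "(\<lambda>w. w) \<in> param_measure A \<rightarrow>\<^sub>M borel" "(\<lambda>z. z) \<in> (cube_measure :: (real ^ 'd) measure) \<rightarrow>\<^sub>M borel"
      by (auto intro: measurable_restrict_space1)
    then have "(\<lambda>p. (fst p, snd p)) \<in> param_measure A \<Otimes>\<^sub>M (cube_measure :: (real ^ 'd) measure) \<rightarrow>\<^sub>M borel \<Otimes>\<^sub>M borel"
      by (intro measurable_Pair measurable_compose[OF measurable_fst] measurable_compose[OF measurable_snd])
    from measurable_sets[OF this B] show ?thesis
      by (simp add: vimage_def Int_def conj_commute)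
  qed
  ultimately show ?thesis
    using sub unfolding test_sets_def test_sets_axioms_def by (auto simp: space_restrict_space)
qed

lemma unit_cube_borel [measurable]: "unit_cube \<in> sets borel"
  unfolding unit_cube_def by measurable

lemma bounded_unit_cube: "bounded unit_cube"
  by (rule bounded_subset[of "cbox 0 1"]) (auto simp: unit_cube_def mem_box_cart)

text \<open>\<open>R\<close> is the order for the extreme discrepancy and always true for the
  periodic one, so both parameter spaces are instances.\<close>

definition pairs :: "(real ^ 'd \<Rightarrow> real ^ 'd \<Rightarrow> bool) \<Rightarrow> ((real ^ 'd) \<times> (real ^ 'd)) set" where
  "pairs R = {(x, y). x \<in> unit_cube \<and> y \<in> unit_cube \<and> R x y}"

lemma bounded_pairs: "bounded (pairs R)"
  by (rule bounded_subset[OF bounded_Times[OF bounded_unit_cube bounded_unit_cube]]) (auto simp: pairs_def)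

lemma pairs_borel:
  "pairs (\<le>) \<in> sets (borel :: ((real ^ 'd) \<times> (real ^ 'd)) measure)"
  "pairs (\<lambda>_ _. True) \<in> sets (borel :: ((real ^ 'd) \<times> (real ^ 'd)) measure)"
proof -
  have "Measurable.pred (borel \<Otimes>\<^sub>M borel) (\<lambda>w::(real ^ 'd) \<times> (real ^ 'd). \<forall>i. 0 \<le> fst w $ i \<and> fst w $ i \<le> snd w $ i \<and> snd w $ i \<le> 1)"
    "Measurable.pred (borel \<Otimes>\<^sub>M borel) (\<lambda>w::(real ^ 'd) \<times> (real ^ 'd). \<forall>i. 0 \<le> fst w $ i \<and> fst w $ i \<le> 1 \<and> 0 \<le> snd w $ i \<and> snd w $ i \<le> 1)"
    by measurable
  moreover have "pairs (\<le>) = {w::(real ^ 'd) \<times> (real ^ 'd). \<forall>i. 0 \<le> fst w $ i \<and> fst w $ i \<le> snd w $ i \<and> snd w $ i \<le> 1}"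
    "pairs (\<lambda>_ _. True) = {w::(real ^ 'd) \<times> (real ^ 'd). \<forall>i. 0 \<le> fst w $ i \<and> fst w $ i \<le> 1 \<and> 0 \<le> snd w $ i \<and> snd w $ i \<le> 1}"
    by (auto simp: pairs_def unit_cube_def less_eq_vec_def) (metis order_trans)+
  ultimately show "pairs (\<le>) \<in> sets (borel :: ((real ^ 'd) \<times> (real ^ 'd)) measure)"
    "pairs (\<lambda>_ _. True) \<in> sets (borel :: ((real ^ 'd) \<times> (real ^ 'd)) measure)"
    unfolding pred_def borel_prod by simp_all
qed

text \<open>Fubini. In the definitions of the discrepancies the first corner \<open>x\<close> is the
  inner variable, so the integral over pairs is unfolded with the second component outside.\<close>

lemma integral_pairs:
  fixes F :: "real ^ 'd \<Rightarrow> real ^ 'd \<Rightarrow> real"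
  assumes A: "pairs R \<in> sets borel"
    and F: "integrable (param_measure (pairs R)) (\<lambda>w. F (fst w) (snd w))"
  shows "(LINT y:unit_cube|lborel. (LINT x:{x \<in> unit_cube. R x y}|lborel. F x y))
    = (\<integral>w. F (fst w) (snd w) \<partial>param_measure (pairs R))"
proof -
  let ?g = "\<lambda>x y. indicator (pairs R) (x, y) * F x y"
  have "integrable lborel (\<lambda>w. indicator (pairs R) w *\<^sub>R F (fst w) (snd w))"
    using F A by (subst (asm) integrable_restrict_space) auto
  then have int: "integrable (lborel \<Otimes>\<^sub>M lborel) (case_prod ?g)"
    by (simp add: lborel_prod case_prod_beta')
  have "(\<integral>w. F (fst w) (snd w) \<partial>param_measure (pairs R)) = integral\<^sup>L (lborel \<Otimes>\<^sub>M lborel) (case_prod ?g)"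
    using A by (simp add: integral_restrict_space lborel_prod case_prod_beta')
  also have "\<dots> = (\<integral>y. (\<integral>x. ?g x y \<partial>lborel) \<partial>lborel)"
    by (rule lborel_pair.integral_snd[OF int, symmetric])
  also have "\<dots> = (LINT y:unit_cube|lborel. (LINT x:{x \<in> unit_cube. R x y}|lborel. F x y))"
    unfolding set_lebesgue_integral_def
    by (intro Bochner_Integration.integral_cong refl) (auto simp: indicator_def pairs_def intro!: Bochner_Integration.integral_cong)
  finally show ?thesis by simp
qed

subsection \<open>The volume integrals\<close>

lemma has_bochner_integral_power_diff:
  fixes a b c :: real
  assumes "a \<le> b"
  shows "has_bochner_integral lborel (\<lambda>x. indicator {a..b} x * (c - x) ^ p)
      (((c - a) ^ Suc p - (c - b) ^ Suc p) / Suc p)"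
proof -
  have "has_bochner_integral lborel (\<lambda>x. (c - x) ^ p * indicator {a..b} x)
     (- ((c - b) ^ Suc p / Suc p) - - ((c - a) ^ Suc p / Suc p))"
    by (rule has_bochner_integral_FTC_Icc_real[OF assms])
      (auto intro!: derivative_eq_intros continuous_intros simp del: power_Suc of_nat_Suc)
  then show ?thesis by (simp add: mult.commute diff_divide_distrib)
qed

lemma has_bochner_integral_power_01:
  "has_bochner_integral lborel (\<lambda>x::real. indicator {0..1} x * x ^ p) (1 / Suc p)"
proof -
  have "has_bochner_integral lborel (\<lambda>x::real. x ^ p * indicator {0..1} x) (1 ^ Suc p / Suc p - 0 ^ Suc p / Suc p)"
    by (rule has_bochner_integral_FTC_Icc_real)
      (auto intro!: derivative_eq_intros continuous_intros simp del: power_Suc of_nat_Suc)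
  then show ?thesis by (simp add: mult.commute)
qed

text \<open>Both the volume and its square are products over the coordinates, so the integral of
  their difference is determined by the first and second moments of the side lengths.\<close>

lemma integral_prod_diff:
  fixes l :: "'d::finite \<Rightarrow> real \<Rightarrow> real"
  assumes "\<And>i p. has_bochner_integral lborel (\<lambda>t. indicator (S i) t * l i t ^ p) (I i p)"
  shows "(LINT x:{x::real ^ 'd. \<forall>i. x $ i \<in> S i}|lborel. (\<Prod>i\<in>UNIV. l i (x $ i)) - (\<Prod>i\<in>UNIV. l i (x $ i))\<^sup>2)
      = (\<Prod>i\<in>UNIV. I i 1) - (\<Prod>i\<in>UNIV. I i 2)"
proof -
  have i: "integrable lborel (\<lambda>t. indicator (S i) t * l i t ^ p)" 
    and e: "(\<integral>t. indicator (S i) t * l i t ^ p \<partial>lborel) = I i p" for i p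
    using assms by (auto simp: has_bochner_integral_iff)
  have "(LINT x:{x::real ^ 'd. \<forall>i. x $ i \<in> S i}|lborel. (\<Prod>i\<in>UNIV. l i (x $ i)) - (\<Prod>i\<in>UNIV. l i (x $ i))\<^sup>2) =
     (\<integral>x. (\<Prod>i\<in>UNIV. indicator (S i) (x $ i) * l i (x $ i) ^ 1) - (\<Prod>i\<in>UNIV. indicator (S i) (x $ i) * l i (x $ i) ^ 2) \<partial>(lborel :: (real ^ 'd) measure))"
    unfolding set_lebesgue_integral_def indicator_coordinatewise
    by (simp add: prod.distrib prod_power_distrib algebra_simps)
  also have "\<dots> = (\<Prod>i\<in>UNIV. I i 1) - (\<Prod>i\<in>UNIV. I i 2)"
    by (subst Bochner_Integration.integral_diff)
      (simp_all only: integrable_lborel_vec_prod[OF i] integral_lborel_vec_prod[OF i] e)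
  finally show ?thesis .
qed

lemma unit_cube_eq: "unit_cube = {x. \<forall>i. x $ i \<in> {0..1}}"
  by (auto simp: unit_cube_def)

lemma integral_star:
  "(LINT t:unit_cube|lborel. (\<Prod>i\<in>UNIV. t $ i) - (\<Prod>i\<in>UNIV. (t :: real ^ 'd) $ i)\<^sup>2) = 1 / 2 ^ CARD('d) - 1 / 3 ^ CARD('d)"
proof -
  show ?thesis
    unfolding unit_cube_eq using integral_prod_diff[where S = "\<lambda>_. {0..1}" and l = "\<lambda>_ t. t", OF has_bochner_integral_power_01]
    by (simp add: power_one_over)
qed

lemma integral_extr:
  "(LINT y:unit_cube|lborel. (LINT x:{x \<in> unit_cube. x \<le> y}|lborel.
      (\<Prod>i\<in>UNIV. y $ i - x $ i) - (\<Prod>i\<in>UNIV. y $ i - (x :: real ^ 'd) $ i)\<^sup>2))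
     = 1 / 6 ^ CARD('d) - 1 / 12 ^ CARD('d)"
proof -
  have inner: "(LINT x:{x \<in> unit_cube. x \<le> y}|lborel.
      (\<Prod>i\<in>UNIV. y $ i - x $ i) - (\<Prod>i\<in>UNIV. y $ i - (x :: real ^ 'd) $ i)\<^sup>2)
     = (\<Prod>i\<in>UNIV. y $ i ^ 2 / 2) - (\<Prod>i\<in>UNIV. y $ i ^ 3 / 3)" if y: "y \<in> unit_cube" for y
  proof -
    have "{x \<in> unit_cube. x \<le> y} = {x. \<forall>i. x $ i \<in> {0..y $ i}}"
      using y by (auto simp: unit_cube_def less_eq_vec_def intro: order_trans)
    moreover have "has_bochner_integral lborel (\<lambda>t. indicator {0..y $ i} t * (y $ i - t) ^ p) (y $ i ^ Suc p / Suc p)" for i p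
      using has_bochner_integral_power_diff[of 0 "y $ i" "y $ i" p] y by (simp add: unit_cube_def)
    from integral_prod_diff[where S = "\<lambda>i. {0..y $ i}" and l = "\<lambda>i t. y $ i - t", OF this]
    have "(LINT x:{x::real ^ 'd. \<forall>i. x $ i \<in> {0..y $ i}}|lborel. (\<Prod>i\<in>UNIV. y $ i - x $ i) - (\<Prod>i\<in>UNIV. y $ i - x $ i)\<^sup>2)
      = (\<Prod>i\<in>UNIV. y $ i ^ 2 / 2) - (\<Prod>i\<in>UNIV. y $ i ^ 3 / 3)"
      by (simp add: numeral_2_eq_2 numeral_3_eq_3)
    ultimately show ?thesis by simp
  qed
  \<comment> \<open>Integrating the inner result \<open>t ^ Suc p / Suc p\<close> over the unit
    interval yields 1/6 for \<open>p = 1\<close> and 1/12 for \<open>p = 2\<close>.\<close>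
  have "has_bochner_integral lborel (\<lambda>t::real. indicator {0..1} t * t ^ Suc p / Suc p) (1 / Suc (Suc p) / Suc p)" for p
    by (intro has_bochner_integral_divide_zero has_bochner_integral_power_01)
  then have i: "integrable lborel (\<lambda>t::real. indicator {0..1} t * (t ^ Suc p / Suc p))"
     and e: "integral\<^sup>L lborel (\<lambda>t::real. indicator {0..1} t * (t ^ Suc p / Suc p)) = 1 / Suc (Suc p) / Suc p" for p
    by (simp_all only: has_bochner_integral_iff times_divide_eq_right)
  have "(LINT y:unit_cube|lborel. (LINT x:{x \<in> unit_cube. x \<le> y}|lborel.
      (\<Prod>i\<in>UNIV. y $ i - x $ i) - (\<Prod>i\<in>UNIV. y $ i - (x :: real ^ 'd) $ i)\<^sup>2))
     = (LINT y:unit_cube|lborel. (\<Prod>i\<in>UNIV. y $ i ^ 2 / 2) - (\<Prod>i\<in>UNIV. (y :: real ^ 'd) $ i ^ 3 / 3))"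
    unfolding set_lebesgue_integral_def[of _ unit_cube]
    by (intro Bochner_Integration.integral_cong refl) (simp add: inner indicator_def)
  also have "\<dots> = (\<integral>y. (\<Prod>i\<in>UNIV. indicator {0..1} (y $ i) * (y $ i ^ Suc 1 / Suc 1)) - 
      (\<Prod>i\<in>UNIV. indicator {0..1} ((y :: real ^ 'd) $ i) * (y $ i ^ Suc 2 / Suc 2)) \<partial>lborel)"
    unfolding set_lebesgue_integral_def unit_cube_eq indicator_coordinatewise prod.distrib
    by (simp add: algebra_simps numeral_2_eq_2 numeral_3_eq_3)
  also have "\<dots> = (\<Prod>i\<in>(UNIV :: 'd set). 1 / Suc (Suc 1) / Suc 1) - (\<Prod>i\<in>(UNIV :: 'd set). 1 / Suc (Suc 2) / Suc 2)"
    by (simp only: Bochner_Integration.integral_diff integrable_lborel_vec_prod[OF i] integral_lborel_vec_prod[OF i] e)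
  also have "\<dots> = 1 / 6 ^ CARD('d) - 1 / 12 ^ CARD('d)"
    by (simp add: power_one_over)
  finally show ?thesis .
qed

definition per_length :: "real \<Rightarrow> real \<Rightarrow> real" where
  "per_length x y = (if x \<le> y then y - x else 1 + y - x)"

text \<open>For a fixed endpoint \<open>s\<close>, the length of the periodic interval from
  \<open>t\<close> to \<open>s\<close> is again uniformly distributed on the unit interval when
  \<open>t\<close> is. The moments are thus those of the star case, and the inner integral does not
  depend on \<open>y\<close>.\<close>

lemma integral_per:
  "(LINT y:unit_cube|lborel. (LINT x:unit_cube|lborel.
      (\<Prod>i\<in>UNIV. per_length (x $ i) (y $ i)) - (\<Prod>i\<in>UNIV. per_length ((x :: real ^ 'd) $ i) (y $ i))\<^sup>2))
     = 1 / 2 ^ CARD('d) - 1 / 3 ^ CARD('d)"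
proof -
  have *: "has_bochner_integral lborel (\<lambda>t. indicator {0..1} t * per_length t s ^ p) (1 / real (Suc p))"
    if s: "0 \<le> s" "s \<le> 1" for s p
  proof -
    have "has_bochner_integral lborel (\<lambda>t. indicator {0..s} t * (s - t) ^ p + indicator {s..1} t * (1 + s - t) ^ p)
       (((s - 0) ^ Suc p - (s - s) ^ Suc p) / Suc p + ((1 + s - s) ^ Suc p - (1 + s - 1) ^ Suc p) / Suc p)"
      using s by (intro has_bochner_integral_add has_bochner_integral_power_diff) auto
    also have "((s - 0) ^ Suc p - (s - s) ^ Suc p) / Suc p + ((1 + s - s) ^ Suc p - (1 + s - 1) ^ Suc p) / Suc p = 1 / real (Suc p)"
      by (simp add: add_divide_distrib[symmetric])
    finally show ?thesis
    proof (rule has_bochner_integral_cong_AE[THEN iffD1, rotated -1])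
      \<comment> \<open>The two pieces overlap at \<open>t = s\<close> alone, a null set.\<close>
      show "AE t in lborel. indicator {0..s} t * (s - t) ^ p + indicator {s..1} t * (1 + s - t) ^ p
          = indicator {0..1} t * per_length t s ^ p"
        using AE_lborel_singleton[of s] by eventually_elim (use s in \<open>auto simp: indicator_def per_length_def\<close>)
      show "(\<lambda>t. indicator {0..1} t * per_length t s ^ p) \<in> borel_measurable lborel"
        unfolding per_length_def by measurable
    qed measurable
  qed
  have inner: "(LINT x:unit_cube|lborel.
      (\<Prod>i\<in>UNIV. per_length (x $ i) (y $ i)) - (\<Prod>i\<in>UNIV. per_length ((x :: real ^ 'd) $ i) (y $ i))\<^sup>2)
     = 1 / 2 ^ CARD('d) - 1 / 3 ^ CARD('d)" if y: "y \<in> unit_cube" for y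
    unfolding unit_cube_eq using y
      integral_prod_diff[where S = "\<lambda>_. {0..1}" and l = "\<lambda>i t. per_length t (y $ i)", OF *]
    by (simp add: power_one_over unit_cube_def)
  have "(LINT y:unit_cube|lborel. (LINT x:unit_cube|lborel.
      (\<Prod>i\<in>UNIV. per_length (x $ i) (y $ i)) - (\<Prod>i\<in>UNIV. per_length ((x :: real ^ 'd) $ i) (y $ i))\<^sup>2))
     = (LINT y:(unit_cube :: (real ^ 'd) set)|lborel. 1 / 2 ^ CARD('d) - 1 / 3 ^ CARD('d))"
    unfolding set_lebesgue_integral_def[of _ unit_cube "\<lambda>y. LINT x:unit_cube|lborel. _ x y"]
      set_lebesgue_integral_def[of _ unit_cube "\<lambda>y. 1 / 2 ^ CARD('d) - 1 / 3 ^ CARD('d)"]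
    by (intro Bochner_Integration.integral_cong refl) (simp add: inner indicator_def)
  also have "\<dots> = measure lborel (unit_cube :: (real ^ 'd) set) * (1 / 2 ^ CARD('d) - 1 / 3 ^ CARD('d))"
    by (simp add: set_lebesgue_integral_def)
  also have "measure lborel (unit_cube :: (real ^ 'd) set) = 1"
    unfolding unit_cube_eq by (subst measure_coordinatewise) auto
  finally show ?thesis by simp
qed


subsection \<open>The three families of test sets\<close>

lemma per_box_eq_ho_box: "x \<le> y \<Longrightarrow> per_box x y = ho_box x y"
  by (auto simp: per_box_def ho_box_def per_interval_def less_eq_vec_def)

lemma measure_per_box:
  fixes x y :: "real ^ 'd"
  assumes "x \<in> unit_cube" "y \<in> unit_cube"
  shows "measure lborel (per_box x y) = (\<Prod>i\<in>UNIV. per_length (x $ i) (y $ i))"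
    and "per_box x y \<in> sets lborel"
proof -
  have *: "emeasure lborel (per_interval a b) = ennreal (per_length a b)" "0 \<le> per_length a b" "per_interval a b \<in> sets lborel"
    if "0 \<le> a" "a \<le> 1" "0 \<le> b" "b \<le> 1" for a b
  proof -
    show "per_interval a b \<in> sets lborel" by (simp add: per_interval_def)
    show "0 \<le> per_length a b" using that by (simp add: per_length_def)
    show "emeasure lborel (per_interval a b) = ennreal (per_length a b)"
    proof (cases "a \<le> b")
      case True
      then show ?thesis by (simp add: per_interval_def per_length_def)
    next
      case False
      then have "emeasure lborel ({0..<b} \<union> {a..<1}) = ennreal (b + (1 - a))"
        using that by (subst plus_emeasure[symmetric]) (auto simp flip: ennreal_plus)
      also have "b + (1 - a) = per_length a b" using False by (simp add: per_length_def)
      finally show ?thesis using False by (simp add: per_interval_def)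
    qed
  qed
  have xy: "0 \<le> x $ i" "x $ i \<le> 1" "0 \<le> y $ i" "y $ i \<le> 1" for i
    using assms by (auto simp: unit_cube_def)
  have m: "measure lborel (per_interval (x $ i) (y $ i)) = per_length (x $ i) (y $ i)" for i
    using *[OF xy[of i]] by (simp add: measure_def)
  note c = measure_coordinatewise[of "\<lambda>i. per_interval (x $ i) (y $ i)", OF *(3)[OF xy]]
  show "measure lborel (per_box x y) = (\<Prod>i\<in>UNIV. per_length (x $ i) (y $ i))"
    unfolding per_box_def by (subst c) (simp_all add: m *(1)[OF xy])
  show "per_box x y \<in> sets lborel"
    unfolding per_box_def by (rule c) (simp add: *(1)[OF xy])
qed

lemma test_sets_star: "test_sets (param_measure unit_cube) (ho_box (0 :: real ^ 'd))"
proof (rule test_setsI)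
  have "Measurable.pred (borel \<Otimes>\<^sub>M borel) (\<lambda>p::(real ^ 'd) \<times> (real ^ 'd). \<forall>i. 0 \<le> snd p $ i \<and> snd p $ i < fst p $ i)"
    by measurable
  then show "{p. snd p \<in> ho_box (0 :: real ^ 'd) (fst p)} \<in> sets (borel \<Otimes>\<^sub>M borel)"
    by (simp add: pred_def space_pair_measure ho_box_def)
  show "w \<in> unit_cube \<Longrightarrow> ho_box 0 w \<subseteq> ho_unit_cube" for w :: "real ^ 'd"
    unfolding unit_cube_def ho_box_def ho_unit_cube_def by clarsimp (meson less_le_trans)
qed (auto simp: bounded_unit_cube)

text \<open>Measurability of the predicate is proved over a threefold product of Borel spaces,
  whereas the set lives over the Borel space of the type of pairs. \<open>borel_prod\<close>
  identifies the two.\<close>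

lemma pred_pairs:
  assumes "Measurable.pred ((borel \<Otimes>\<^sub>M borel) \<Otimes>\<^sub>M borel) (\<lambda>p. P (fst (fst p)) (snd (fst p)) (snd p))"
  shows "{p :: ((real ^ 'd) \<times> (real ^ 'd)) \<times> (real ^ 'd). P (fst (fst p)) (snd (fst p)) (snd p)} \<in> sets (borel \<Otimes>\<^sub>M borel)"
  using assms unfolding pred_def borel_prod by simp

lemma test_sets_extr:
  "test_sets (param_measure (pairs (\<le>))) (\<lambda>w. ho_box (fst w) (snd w) :: (real ^ 'd) set)"
proof (rule test_setsI)
  show "{p. snd p \<in> ho_box (fst (fst p)) (snd (fst p) :: real ^ 'd)} \<in> sets (borel \<Otimes>\<^sub>M borel)"
    unfolding ho_box_def mem_Collect_eq by (rule pred_pairs) measurable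
  show "w \<in> pairs (\<le>) \<Longrightarrow> ho_box (fst w) (snd w) \<subseteq> ho_unit_cube" for w :: "(real ^ 'd) \<times> (real ^ 'd)"
    unfolding pairs_def unit_cube_def ho_box_def ho_unit_cube_def
    by clarsimp (meson less_le_trans order_trans)
qed (auto simp: bounded_pairs pairs_borel)

lemma test_sets_per:
  "test_sets (param_measure (pairs (\<lambda>_ _. True))) (\<lambda>w. per_box (fst w) (snd w) :: (real ^ 'd) set)"
proof (rule test_setsI)
  have eq: "z \<in> per_interval x y \<longleftrightarrow> (if x \<le> y then x \<le> z \<and> z < y else (0 \<le> z \<and> z < y) \<or> (x \<le> z \<and> z < 1))" for x y z
    by (auto simp: per_interval_def)
  show "{p. snd p \<in> per_box (fst (fst p)) (snd (fst p) :: real ^ 'd)} \<in> sets (borel \<Otimes>\<^sub>M borel)"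
    unfolding per_box_def mem_Collect_eq eq by (rule pred_pairs) measurable
  show "w \<in> pairs (\<lambda>_ _. True) \<Longrightarrow> per_box (fst w) (snd w) \<subseteq> ho_unit_cube" for w :: "(real ^ 'd) \<times> (real ^ 'd)"
    unfolding pairs_def unit_cube_def per_box_def ho_unit_cube_def mem_Collect_eq eq
    by clarsimp (smt (verit))
qed (auto simp: bounded_pairs pairs_borel)

text \<open>For the extreme and periodic families a nonnegative weight is enough: the corners range
  over pairs close to \<open>x\<close> and \<open>y\<close>, and every box with such corners lies
  between the shrunk box and \<open>ho_box x y\<close>.\<close>

lemma separates_pairs:
  fixes x y :: "real ^ 'd"
  assumes T: "test_sets (param_measure A) B" and A: "A \<in> sets borel" "pairs (\<le>) \<subseteq> A"
    and B: "\<And>w. w \<in> pairs (\<le>) \<Longrightarrow> B w = ho_box (fst w) (snd w)"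
    and x: "x \<in> unit_cube" and y: "y \<in> unit_cube" and \<delta>: "0 < \<delta>" "\<And>i. 2 * \<delta> < y $ i - x $ i"
  shows "\<exists>G. test_sets.separates (param_measure A) B G (shrunk_box \<delta> x y) (ho_box x y)"
proof -
  interpret test_sets "param_measure A" B by (rule T)
  let ?K = "cbox x (\<chi> i. x $ i + \<delta>) \<times> cbox (\<chi> i. y $ i - \<delta>) y"
  \<comment> \<open>The condition on \<delta> keeps the two ranges of corners apart, so all pairs in
    \<open>?K\<close> are ordered and \<open>B\<close> gives ordinary boxes there.\<close>
  have xd: "x $ i + \<delta> < y $ i - \<delta>" for i using \<delta>(2)[of i] by simp
  have K: "x $ i \<le> fst w $ i" "fst w $ i \<le> x $ i + \<delta>" "y $ i - \<delta> \<le> snd w $ i" "snd w $ i \<le> y $ i"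
    if "w \<in> ?K" for w i using that by (auto simp: mem_box_cart)
  have KP: "?K \<subseteq> pairs (\<le>)"
  proof
    fix w assume w: "w \<in> ?K"
    have "0 \<le> fst w $ i \<and> fst w $ i \<le> 1 \<and> 0 \<le> snd w $ i \<and> snd w $ i \<le> 1 \<and> fst w $ i \<le> snd w $ i" for i
      using K[OF w, of i] xd[of i] x y \<delta>(1) by (auto simp: unit_cube_def; smt (verit))
    then show "w \<in> pairs (\<le>)" by (auto simp: pairs_def unit_cube_def less_eq_vec_def case_prod_beta')
  qed
  have Ke: "?K = cbox (x, \<chi> i. y $ i - \<delta>) (\<chi> i. x $ i + \<delta>, y)" by (simp add: cbox_Pair_eq)
  have "measure lborel ?K = (\<Prod>i\<in>(UNIV::'d set). \<delta>) * (\<Prod>i\<in>(UNIV::'d set). \<delta>)"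
    unfolding Ke content_Pair using \<delta>(1) by (subst (1 2) content_cbox_cart) (simp_all add: interval_ne_empty_cart)
  then have m: "measure (param_measure A) ?K > 0"
    using A KP \<delta>(1) by (subst measure_restrict_space) auto
  have s: "?K \<in> sets (param_measure A)"
    using A KP unfolding Ke by (subst sets_restrict_space_iff) auto
  have "separates (\<lambda>w. indicator ?K w / measure (param_measure A) ?K) (shrunk_box \<delta> x y) (ho_box x y)"
  proof (rule separates_normalized_indicator[OF s m])
    fix w assume w: "w \<in> ?K"
    show "shrunk_box \<delta> x y \<subseteq> B w"
      using B[of w] KP w K[OF w] by (auto simp: shrunk_box_def ho_box_def subset_iff; smt (verit))
    show "B w \<subseteq> ho_box x y"
      using B[of w] KP w K[OF w] by (auto simp: ho_box_def subset_iff; smt (verit))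
  qed
  then show ?thesis by blast
qed

text \<open>The weight below is signed: in each coordinate, integrating it against \<open>[z < t]\<close> gives the trapezoid
  that vanishes outside \<open>[x, y)\<close>, equals 1 on \<open>[x + \<delta>, y - \<delta>)\<close> and is linear in between.\<close>

lemma trapezoid:
  fixes x y z \<delta> :: real
  assumes "0 < \<delta>" "2 * \<delta> < y - x"
  defines "h \<equiv> \<lambda>t. (indicator {max z (y - \<delta>)<..y} t - indicator {max z x<..x + \<delta>} t) / \<delta>"
  shows "integrable lborel h" "0 \<le> integral\<^sup>L lborel h" "integral\<^sup>L lborel h \<le> 1"
    "\<not> (x \<le> z \<and> z < y) \<Longrightarrow> integral\<^sup>L lborel h = 0" "x + \<delta> \<le> z \<Longrightarrow> z < y - \<delta> \<Longrightarrow> integral\<^sup>L lborel h = 1"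
proof -
  have m: "measure lborel {a<..b} = max 0 (b - a)" for a b :: real
    by (cases "a \<le> b") (auto simp: max_def)
  have f: "emeasure lborel {a<..b} < \<infinity>" for a b :: real by (cases "a \<le> b") auto
  have i: "integrable lborel (indicator {a<..b} :: real \<Rightarrow> real)" for a b :: real
    using f by (simp add: integrable_indicator_iff)
  show "integrable lborel h" unfolding h_def using i by auto
  \<comment> \<open>\<open>max 0\<close> covers intervals that become empty once \<open>z\<close>
    passes their right end.\<close>
  have "integral\<^sup>L lborel h = (max 0 (y - max z (y - \<delta>)) - max 0 (x + \<delta> - max z x)) / \<delta>"
    unfolding h_def using i by (simp add: m)
  then have e: "integral\<^sup>L lborel h * \<delta> = max 0 (y - max z (y - \<delta>)) - max 0 (x + \<delta> - max z x)"
    using assms by simp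
  have "0 \<le> integral\<^sup>L lborel h * \<delta>" "integral\<^sup>L lborel h * \<delta> \<le> 1 * \<delta>" unfolding e using assms by auto
  then show "0 \<le> integral\<^sup>L lborel h" "integral\<^sup>L lborel h \<le> 1" 
    using assms(1) by (simp_all add: zero_le_mult_iff)
  show "integral\<^sup>L lborel h = 0" if "\<not> (x \<le> z \<and> z < y)"
  proof -
    have "integral\<^sup>L lborel h * \<delta> = 0" unfolding e using assms that by auto
    then show ?thesis using assms(1) by simp
  qed
  show "integral\<^sup>L lborel h = 1" if "x + \<delta> \<le> z" "z < y - \<delta>"
  proof -
    have "integral\<^sup>L lborel h * \<delta> = 1 * \<delta>" unfolding e using assms that by auto
    then show ?thesis using assms(1) by simp
  qed
qed

text \<open>Boxes anchored at the origin cannot in general be confined to a given box, so the weight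
  has to change sign. Membership of \<open>z\<close> in \<open>ho_box 0 t\<close> and the weight
  both factor over the coordinates, which makes the test function a product of trapezoids.\<close>

lemma separates_star:
  fixes x y :: "real ^ 'd"
  assumes x: "x \<in> unit_cube" and y: "y \<in> unit_cube" and \<delta>: "0 < \<delta>" "\<And>i. 2 * \<delta> < y $ i - x $ i"
  shows "\<exists>G. test_sets.separates (param_measure unit_cube) (ho_box 0) G (shrunk_box \<delta> x y) (ho_box x y)"
proof -
  interpret test_sets "param_measure unit_cube" "ho_box (0 :: real ^ 'd)" by (rule test_sets_star)
  \<comment> \<open>The indicator of a side is the difference of the conditions
    \<open>z < y $ i\<close> and \<open>z < x $ i\<close>; here each threshold is smeared over an
    interval of length \<delta> within the side. \<open>h\<close> below is \<open>g\<close> cut off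
    at \<open>z\<close>.\<close>
  define g where "g i s = (indicator {y $ i - \<delta><..y $ i} s - indicator {x $ i<..x $ i + \<delta>} s) / \<delta>" for i s
  define h where "h z i s = (indicator {max z (y $ i - \<delta>)<..y $ i} s - indicator {max z (x $ i)<..x $ i + \<delta>} s) / \<delta>"
    for z i and s :: real
  define G where "G t = (\<Prod>i\<in>UNIV. g i (t $ i))" for t :: "real ^ 'd"
  have [measurable]: "g i \<in> borel_measurable borel" for i unfolding g_def by measurable
  have G1: "G \<in> borel_measurable (param_measure unit_cube)"
    unfolding G_def by (rule measurable_restrict_space1) measurable
  have "\<bar>g i s\<bar> \<le> 1 / \<delta>" for i s
    using \<delta>(1) by (auto simp: g_def indicator_def abs_if)
  then have G2: "\<bar>G t\<bar> \<le> (1 / \<delta>) ^ CARD('d)" for t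
    using prod_mono[of UNIV "\<lambda>i. \<bar>g i (t $ i)\<bar>" "\<lambda>_. 1 / \<delta>"] unfolding G_def abs_prod by simp
  have x0: "0 \<le> x $ i" and y1: "y $ i \<le> 1" for i using x y by (auto simp: unit_cube_def)
  have f: "(\<integral>t. G t * hit t z \<partial>param_measure unit_cube) = (\<Prod>i\<in>UNIV. integral\<^sup>L lborel (h (z $ i) i))"
    if z: "z \<in> ho_unit_cube" for z
  proof -
    \<comment> \<open>Restricting to the unit interval changes nothing, because the weight is
      supported between \<open>x $ i\<close> and \<open>y $ i\<close>.\<close>
    have "indicator {0..1} s * (g i s * indicator {u. z $ i < u} s) = h (z $ i) i s" for i s
      using \<delta>(1) x0[of i] y1[of i] \<delta>(2)[of i] z by (auto simp: g_def h_def indicator_def)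
    moreover have "hit t z = (\<Prod>i\<in>UNIV. indicator {u. z $ i < u} (t $ i))" for t
      using z by (simp add: hit_def ho_box_def ho_unit_cube_def indicator_def)
    ultimately have "indicator unit_cube t * (G t * hit t z) = (\<Prod>i\<in>UNIV. h (z $ i) i (t $ i))" for t
      unfolding unit_cube_eq indicator_coordinatewise G_def by (simp flip: prod.distrib)
    then have "(\<integral>t. G t * hit t z \<partial>param_measure unit_cube) = (\<integral>t. (\<Prod>i\<in>UNIV. h (z $ i) i (t $ i)) \<partial>(lborel :: (real ^ 'd) measure))"
      by (simp add: integral_restrict_space)
    also have "\<dots> = (\<Prod>i\<in>UNIV. integral\<^sup>L lborel (h (z $ i) i))"
      unfolding h_def by (intro integral_lborel_vec_prod trapezoid \<delta>)
    finally show ?thesis .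
  qed
  note h = trapezoid[OF \<delta>, folded h_def]
  have "indicator (shrunk_box \<delta> x y) z \<le> (\<integral>t. G t * hit t z \<partial>param_measure unit_cube)
      \<and> (\<integral>t. G t * hit t z \<partial>param_measure unit_cube) \<le> indicator (ho_box x y) z"
    if z: "z \<in> ho_unit_cube" for z
  proof -
    let ?p = "\<Prod>i\<in>UNIV. integral\<^sup>L lborel (h (z $ i) i)"
    have "0 \<le> ?p" "?p \<le> 1" using h(2,3) by (auto intro: prod_nonneg prod_le_1)
    moreover have "?p = 0" if "z \<notin> ho_box x y"
      using that h(4) by (auto simp: ho_box_def)
    moreover have "?p = 1" if "z \<in> shrunk_box \<delta> x y"
      using that h(5) by (intro prod.neutral) (auto simp: ho_box_def shrunk_box_def)
    ultimately show ?thesis unfolding f[OF z] by (auto simp: indicator_def)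
  qed
  then have "separates G (shrunk_box \<delta> x y) (ho_box x y)"
    unfolding separates_def using G1 G2 by blast
  then show ?thesis by blast
qed

text \<open>Exchanges \<open>vol\<close> for a closed volume formula valid on the parameter space.
  Integrability is carried along because Fubini for pairs asks for it.\<close>

lemma (in test_sets) integral_vol:
  assumes "\<And>w. w \<in> space M \<Longrightarrow> measure lebesgue (B w) = v w"
  shows "(\<integral>w. vol w - (vol w)\<^sup>2 \<partial>M) = (\<integral>w. v w - (v w)\<^sup>2 \<partial>M)" "integrable M (\<lambda>w. v w - (v w)\<^sup>2)"
  using assms integrable_vol
  by (auto simp: vol_def intro!: Bochner_Integration.integral_cong cong: Bochner_Integration.integrable_cong)

section \<open>The growth bound and uniform distribution for each kind of discrepancy\<close>

lemma greedy_star: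
  fixes X :: "nat \<Rightarrow> real ^ 'd"
  assumes "k \<ge> 1" "\<And>n. n \<ge> 1 \<Longrightarrow> X n \<in> ho_unit_cube"
    and "\<And>N. N \<ge> k \<Longrightarrow> X (Suc N) \<in> argmin_on ho_unit_cube (\<lambda>y. L2_star (Suc N) (X(Suc N := y)))"
  shows "(\<forall>N\<ge>k. (L2_star N X)\<^sup>2 \<le> max (disc_const Star CARD('d)) ((L2_star k X)\<^sup>2) * real (N - k + 1))
    \<and> uniformly_distributed_mod1 X"
proof -
  interpret test_sets "param_measure unit_cube" "ho_box (0 :: real ^ 'd)" by (rule test_sets_star)
  have v: "measure lebesgue (ho_box 0 t) = (\<Prod>i\<in>UNIV. t $ i)" if "t \<in> space (param_measure unit_cube)"
    for t :: "real ^ 'd"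
    using that measure_ho_box[of 0 t] by (simp add: space_restrict_space unit_cube_def)
  show ?thesis
  proof (rule greedy_sequence[where L = L2_star, OF _ _ separates_star assms])
    show "L2_star N Y = sqrt (\<integral>w. (err N Y w)\<^sup>2 \<partial>param_measure unit_cube)" for N and Y :: "nat \<Rightarrow> real ^ 'd"
      by (simp add: L2_star_def err_def set_lebesgue_integral_def integral_restrict_space)
    have "(\<integral>w. vol w - (vol w)\<^sup>2 \<partial>param_measure unit_cube) =
      (\<integral>t. (\<Prod>i\<in>UNIV. t $ i) - (\<Prod>i\<in>UNIV. (t :: real ^ 'd) $ i)\<^sup>2 \<partial>param_measure unit_cube)"
      by (rule integral_vol(1)) (rule v)
    also have "\<dots> = (LINT t:unit_cube|lborel. (\<Prod>i\<in>UNIV. t $ i) - (\<Prod>i\<in>UNIV. (t :: real ^ 'd) $ i)\<^sup>2)"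
      by (simp add: set_lebesgue_integral_def integral_restrict_space)
    finally show "(\<integral>w. vol w - (vol w)\<^sup>2 \<partial>param_measure unit_cube) = disc_const Star CARD('d)"
      by (simp add: integral_star)
  qed
qed

lemma greedy_extr:
  fixes X :: "nat \<Rightarrow> real ^ 'd"
  assumes "k \<ge> 1" "\<And>n. n \<ge> 1 \<Longrightarrow> X n \<in> ho_unit_cube"
    and "\<And>N. N \<ge> k \<Longrightarrow> X (Suc N) \<in> argmin_on ho_unit_cube (\<lambda>y. L2_extr (Suc N) (X(Suc N := y)))"
  shows "(\<forall>N\<ge>k. (L2_extr N X)\<^sup>2 \<le> max (disc_const Extr CARD('d)) ((L2_extr k X)\<^sup>2) * real (N - k + 1))
    \<and> uniformly_distributed_mod1 X"
proof -
  interpret test_sets "param_measure (pairs (\<le>))" "\<lambda>w. ho_box (fst w) (snd w) :: (real ^ 'd) set"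
    by (rule test_sets_extr)
  have v: "measure lebesgue (ho_box (fst w) (snd w)) = (\<Prod>i\<in>UNIV. snd w $ i - fst w $ i)"
    if "w \<in> space (param_measure (pairs (\<le>)))" for w :: "(real ^ 'd) \<times> (real ^ 'd)"
    using that measure_ho_box[of "fst w" "snd w"]
    by (auto simp: space_restrict_space pairs_def less_eq_vec_def)
  show ?thesis
  proof (rule greedy_sequence[where L = L2_extr, OF _ _ _ assms])
    \<comment> \<open>For points in the cube the squared error is integrable, which lets the
      iterated integral become one over pairs.\<close>
    show "L2_extr N Y = sqrt (\<integral>w. (err N Y w)\<^sup>2 \<partial>param_measure (pairs (\<le>)))"
      if "\<And>n. n \<in> {1..N} \<Longrightarrow> Y n \<in> ho_unit_cube" for N and Y :: "nat \<Rightarrow> real ^ 'd"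
      using integral_pairs[OF pairs_borel(1), of "\<lambda>x y. (local_disc N (ho_box x y) Y)\<^sup>2"] integrable_err_sq[OF that]
      by (simp add: L2_extr_def err_def)
    show "(\<integral>w. vol w - (vol w)\<^sup>2 \<partial>param_measure (pairs (\<le>))) = disc_const Extr CARD('d)"
      using integral_pairs[OF pairs_borel(1) integral_vol(2)[OF v]] integral_vol(1)[OF v]
      by (simp add: integral_extr)
    show "\<exists>G. separates G (shrunk_box \<delta> x y) (ho_box x y)"
      if "x \<in> unit_cube" "y \<in> unit_cube" "0 < \<delta>" "\<And>i. 2 * \<delta> < y $ i - x $ i" for x y :: "real ^ 'd" and \<delta>
      by (rule separates_pairs[OF test_sets_extr pairs_borel(1) _ _ that]) auto
  qed
qed

lemma greedy_per:
  fixes X :: "nat \<Rightarrow> real ^ 'd"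
  assumes "k \<ge> 1" "\<And>n. n \<ge> 1 \<Longrightarrow> X n \<in> ho_unit_cube"
    and "\<And>N. N \<ge> k \<Longrightarrow> X (Suc N) \<in> argmin_on ho_unit_cube (\<lambda>y. L2_per (Suc N) (X(Suc N := y)))"
  shows "(\<forall>N\<ge>k. (L2_per N X)\<^sup>2 \<le> max (disc_const Per CARD('d)) ((L2_per k X)\<^sup>2) * real (N - k + 1))
    \<and> uniformly_distributed_mod1 X"
proof -
  interpret test_sets "param_measure (pairs (\<lambda>_ _. True))" "\<lambda>w. per_box (fst w) (snd w) :: (real ^ 'd) set"
    by (rule test_sets_per)
  have v: "measure lebesgue (per_box (fst w) (snd w)) = (\<Prod>i\<in>UNIV. per_length (fst w $ i) (snd w $ i))"
    if "w \<in> space (param_measure (pairs (\<lambda>_ _. True)))" for w :: "(real ^ 'd) \<times> (real ^ 'd)"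
    using that measure_per_box[of "fst w" "snd w"]
    by (auto simp: space_restrict_space pairs_def)
  show ?thesis
  proof (rule greedy_sequence[where L = L2_per, OF _ _ _ assms])
    show "L2_per N Y = sqrt (\<integral>w. (err N Y w)\<^sup>2 \<partial>param_measure (pairs (\<lambda>_ _. True)))"
      if "\<And>n. n \<in> {1..N} \<Longrightarrow> Y n \<in> ho_unit_cube" for N and Y :: "nat \<Rightarrow> real ^ 'd"
      using integral_pairs[OF pairs_borel(2), of "\<lambda>x y. (local_disc N (per_box x y) Y)\<^sup>2"] integrable_err_sq[OF that]
      by (simp add: L2_per_def err_def)
    show "(\<integral>w. vol w - (vol w)\<^sup>2 \<partial>param_measure (pairs (\<lambda>_ _. True))) = disc_const Per CARD('d)"
      using integral_pairs[OF pairs_borel(2) integral_vol(2)[OF v]] integral_vol(1)[OF v]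
      by (simp add: integral_per)
    \<comment> \<open>Ordered pairs are among the parameters, and for them the periodic box is an
      ordinary box.\<close>
    show "\<exists>G. separates G (shrunk_box \<delta> x y) (ho_box x y)"
      if "x \<in> unit_cube" "y \<in> unit_cube" "0 < \<delta>" "\<And>i. 2 * \<delta> < y $ i - x $ i" for x y :: "real ^ 'd" and \<delta>
      by (rule separates_pairs[OF test_sets_per pairs_borel(2) _ _ that])
        (auto simp: pairs_def per_box_eq_ho_box)
  qed
qed

theorem theorem1:
  fixes kind :: disc_kind
    and k :: nat
    and P X :: "nat \<Rightarrow> real ^ 'd"
  assumes "k \<ge> 1"
    and "\<forall>n\<in>{1..k}. P n \<in> ho_unit_cube"
    and "\<forall>n\<ge>1. X n \<in> ho_unit_cube"
    and "\<forall>n\<in>{1..k}. X n = P n"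
    and "\<forall>N\<ge>k. X (Suc N) \<in>
           argmin_on ho_unit_cube (\<lambda>y. L2_disc kind (Suc N) (X(Suc N := y)))"
  shows "(\<forall>N\<ge>k. (L2_disc kind N X)\<^sup>2
            \<le> max (disc_const kind CARD('d)) ((L2_disc kind k P)\<^sup>2) * real (N - k + 1))
         \<and> uniformly_distributed_mod1 X"
proof -
  \<comment> \<open>The discrepancy at \<open>k\<close> depends on the first \<open>k\<close> points
    only, where \<open>P\<close> and \<open>X\<close> agree.\<close>
  have "{n \<in> {1..k}. P n \<in> B} = {n \<in> {1..k}. X n \<in> B}" for B
    using assms(4) by auto
  then have "local_disc k B P = local_disc k B X" for B
    by (simp only: local_disc_def)
  then have "L2_disc kind k P = L2_disc kind k X"
    by (cases kind) (simp_all add: L2_star_def L2_extr_def L2_per_def)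
  then show ?thesis
    using assms greedy_star[of k X] greedy_extr[of k X] greedy_per[of k X] by (cases kind) simp_all
qed

end
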